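(* Let $R$ be a ring and $\kappa$ an infinite cardinal. Let $F\xrightarrow{f_0}F\xrightarrow{f_1}F\xrightarrow{f_2}\cdots$ be a countable direct system of modules, all equal to a fixed module $F$, with direct limit $N\neq 0$, and let $E,X\subseteq\kappa^+$, the module $M=M_{\kappa^+}$ and its submodules $M_A$ ($A\subseteq\kappa^+$) be constructed from these data as described in the context. Let $\mathcal{C}$ denote the class of all modules that are isomorphic to a countable direct sum of copies of $F$, and let $\mathcal{T}$ be the set of all countable subsets of $E\cup X$. Then $\mathcal{U}=\{M_A\}_{A\in\mathcal{T}}$ is an $\aleph_1$-dense system in $M$ consisting of modules from $\mathcal{C}$.
   Context: Rings are associative with $1$, modules are unital, and "module" means right $R$-module. Countable direct sums may be finite or infinite. A direct system (i.e. a family directed by inclusion) $\mathcal{U}$ of submodules of $M$ is an $\aleph_1$-dense system in $M$ if (1) $\mathcal{U}$ is closed under unions of countable well-ordered ascending chains, and (2) every countable subset of $M$ is contained in an element of $\mathcal{U}$. Construction. Let $E=\{\alpha<\kappa^+\mid\mathrm{cf}(\alpha)=\aleph_0\}$. For each $\nu\in E$ fix a strictly increasing sequence $s_\nu=(s_\nu(i)\mid i<\omega)$ of ordinals less than $\nu$ with $\sup_{i<\omega}s_\nu(i)=\nu$, chosen so that $s_\nu(i)=\tau_{\nu,i}+i+1$ where each $\tau_{\nu,i}$ is a limit ordinal or $0$. (Hence $s_\mu(i)=s_\nu(j)$ implies $i=j$, and $s_\nu(i)\notin E$.) For $\alpha<\kappa^+$ put $F_\alpha=F$ if $\alpha\notin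 E$, and $F_\alpha=\bigoplus_{i<\omega}F_{\alpha,i}$ with each $F_{\alpha,i}=F$ if $\alpha\in E$. Let $P=\bigoplus_{\alpha<\kappa^+}F_\alpha$, with the $F_\alpha$ regarded as submodules of $P$. For $\alpha\in E$ and $i<\omega$ let $g_{\alpha i}=1_{s_\alpha(i)}-1_{\alpha,i}+f_{\alpha,i}$, where $1_{s_\alpha(i)}$ is the canonical identification $F_{\alpha,i}=F=F_{s_\alpha(i)}$, $1_{\alpha,i}$ is the identity on $F_{\alpha,i}$, and $f_{\alpha,i}$ maps $F_{\alpha,i}$ to $F_{\alpha,i+1}$ via $f_i$; explicitly, $$\mathrm{Im}(g_{\alpha i})=\{\,x_{(s_\alpha(i))}-x_{(\alpha,i)}+f_i(x)_{(\alpha,i+1)}\mid x\in F\,\}\subseteq P,$$ where $x_{(\beta)}$ denotes the copy of $x$ in $F_\beta$ ($\beta\notin E$) and $x_{(\alpha,i)}$ the copy of $x$ in $F_{\alpha,i}$. These images are independent submodules of $P$. Let $G_\alpha=\bigoplus_{i<\omega}\mathrm{Im}(g_{\alpha i})$ for $\alpha\in E$, $G=\bigoplus_{\alpha\in E}G_\alpha$, and $M=M_{\kappa^+}=P/G$. For each $A\subseteq\kappa^+$ let $M_A=\bigl(\bigoplus_{\beta\in A}F_\beta+G\bigr)/G\subseteq M$. Finally let $Y=\bigcup_{\alpha\in E}\{s_\alpha(i)\mid i<\omega\}$ and $X=\{\beta<\kappa^+\mid\beta\notin E\cup Y\}$. *)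

theory Defs
  imports "HOL-Algebra.Algebra" "HOL-Library.Countable_Set"
begin

section \<open>Right modules\<close>

text \<open>
  The library locale \<^locale>\<open>module\<close> is about modules over commutative rings, so only its record type
  is reused here. The scalar \<open>r \<odot>\<^bsub>M\<^esub> x\<close> stands for the right action \<open>x r\<close>, whence the order of
  the factors in \<open>smult_assoc\<close>. The multiplicative fields of a module record are never used.
\<close>

locale right_module = R?: ring R + M?: abelian_group M
  for R :: "('r, 'a) ring_scheme" (structure) and M :: "('r, 'm, 'b) module_scheme" (structure) +
  assumes smult_closed:
      "\<lbrakk>r \<in> carrier R; x \<in> carrier M\<rbrakk> \<Longrightarrow> r \<odot>\<^bsub>M\<^esub> x \<in> carrier M"
    and smult_l_distr:
      "\<lbrakk>r \<in> carrier R; t \<in> carrier R; x \<in> carrier M\<rbrakk> \<Longrightarrow>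
        (r \<oplus> t) \<odot>\<^bsub>M\<^esub> x = r \<odot>\<^bsub>M\<^esub> x \<oplus>\<^bsub>M\<^esub> t \<odot>\<^bsub>M\<^esub> x"
    and smult_r_distr:
      "\<lbrakk>r \<in> carrier R; x \<in> carrier M; y \<in> carrier M\<rbrakk> \<Longrightarrow>
        r \<odot>\<^bsub>M\<^esub> (x \<oplus>\<^bsub>M\<^esub> y) = r \<odot>\<^bsub>M\<^esub> x \<oplus>\<^bsub>M\<^esub> r \<odot>\<^bsub>M\<^esub> y"
    and smult_assoc:
      "\<lbrakk>r \<in> carrier R; t \<in> carrier R; x \<in> carrier M\<rbrakk> \<Longrightarrow>
        (r \<otimes> t) \<odot>\<^bsub>M\<^esub> x = t \<odot>\<^bsub>M\<^esub> (r \<odot>\<^bsub>M\<^esub> x)"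
    and smult_one:
      "x \<in> carrier M \<Longrightarrow> \<one> \<odot>\<^bsub>M\<^esub> x = x"

definition right_module_hom ::
  "('r, 'a) ring_scheme \<Rightarrow> ('r, 'm, 'b) module_scheme \<Rightarrow> ('r, 'n, 'c) module_scheme \<Rightarrow> ('m \<Rightarrow> 'n) set"
  where "right_module_hom R M N =
    {h \<in> carrier M \<rightarrow> carrier N.
      (\<forall>x\<in>carrier M. \<forall>y\<in>carrier M. h (x \<oplus>\<^bsub>M\<^esub> y) = h x \<oplus>\<^bsub>N\<^esub> h y) \<and>
      (\<forall>r\<in>carrier R. \<forall>x\<in>carrier M. h (r \<odot>\<^bsub>M\<^esub> x) = r \<odot>\<^bsub>N\<^esub> h x)}"

definition right_module_isomorphic ::
  "('r, 'a) ring_scheme \<Rightarrow> ('r, 'm, 'b) module_scheme \<Rightarrow> ('r, 'n, 'c) module_scheme \<Rightarrow> bool"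
  where "right_module_isomorphic R M N \<longleftrightarrow>
    (\<exists>h\<in>right_module_hom R M N. bij_betw h (carrier M) (carrier N))"

definition submodule_span ::
  "('r, 'a) ring_scheme \<Rightarrow> ('r, 'm, 'b) module_scheme \<Rightarrow> 'm set \<Rightarrow> 'm set"
  where "submodule_span R M S = (\<lambda>U. submodule U R M) hull S"

definition quotient_module ::
  "('r, 'm, 'b) module_scheme \<Rightarrow> 'm set \<Rightarrow> ('r, 'm set) module"
  where "quotient_module M H =
    \<lparr>carrier = a_rcosets\<^bsub>M\<^esub> H, monoid.mult = undefined, one = undefined,
     ring.zero = H, add = (<+>\<^bsub>M\<^esub>),
     smult = (\<lambda>r C. \<Union>x\<in>C. H +>\<^bsub>M\<^esub> (r \<odot>\<^bsub>M\<^esub> x))\<rparr>"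

definition direct_sum ::
  "'i set \<Rightarrow> ('i \<Rightarrow> ('r, 'm, 'b) module_scheme) \<Rightarrow> ('r, 'i \<Rightarrow> 'm) module"
  where "direct_sum I D =
    \<lparr>carrier = {p \<in> \<Pi>\<^sub>E i\<in>I. carrier (D i). finite {i \<in> I. p i \<noteq> \<zero>\<^bsub>D i\<^esub>}},
     monoid.mult = undefined, one = undefined,
     ring.zero = (\<lambda>i\<in>I. \<zero>\<^bsub>D i\<^esub>),
     add = (\<lambda>p q. \<lambda>i\<in>I. p i \<oplus>\<^bsub>D i\<^esub> q i),
     smult = (\<lambda>r p. \<lambda>i\<in>I. r \<odot>\<^bsub>D i\<^esub> p i)\<rparr>"

definition summand_inj ::
  "'i set \<Rightarrow> ('i \<Rightarrow> ('r, 'm, 'b) module_scheme) \<Rightarrow> 'i \<Rightarrow> 'm \<Rightarrow> ('i \<Rightarrow> 'm)"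
  where "summand_inj I D j x = (\<lambda>i\<in>I. if i = j then x else \<zero>\<^bsub>D i\<^esub>)"

definition direct_limit ::
  "('r, 'a) ring_scheme \<Rightarrow> (nat \<Rightarrow> ('r, 'm, 'b) module_scheme) \<Rightarrow> (nat \<Rightarrow> 'm \<Rightarrow> 'm) \<Rightarrow>
    ('r, (nat \<Rightarrow> 'm) set) module"
  where "direct_limit R D f =
    (let S = direct_sum UNIV D; \<iota> = summand_inj UNIV D
     in quotient_module S (submodule_span R S (\<Union>i. {\<iota> i x \<ominus>\<^bsub>S\<^esub> \<iota> (Suc i) (f i x) |x. x \<in> carrier (D i)})))"

text \<open>The class of modules isomorphic to a countable (finite or infinite) direct sum of copies of \<open>F\<close>.
  Since only the cardinality of the index set matters, it may be taken inside the natural numbers.\<close>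

definition is_countable_sum_of ::
  "('r, 'a) ring_scheme \<Rightarrow> ('r, 'f, 'b) module_scheme \<Rightarrow> ('r, 'm, 'c) module_scheme \<Rightarrow> bool"
  where "is_countable_sum_of R F M \<longleftrightarrow>
    right_module R M \<and> (\<exists>I::nat set. right_module_isomorphic R M (direct_sum I (\<lambda>_. F)))"

text \<open>A chain enters the closure condition as the set of its members, well-ordered by inclusion;
  the empty chain is excluded. Repetitions in an indexed chain do not affect its union.\<close>

definition aleph1_dense_system ::
  "('r, 'a) ring_scheme \<Rightarrow> ('r, 'm, 'b) module_scheme \<Rightarrow> 'm set set \<Rightarrow> bool"
  where "aleph1_dense_system R M \<U> \<longleftrightarrow>
    (\<forall>U\<in>\<U>. submodule U R M) \<and>
    \<U> \<noteq> {} \<and> (\<forall>U\<in>\<U>. \<forall>V\<in>\<U>. \<exists>W\<in>\<U>. U \<subseteq> W \<and> V \<subseteq> W) \<and>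
    (\<forall>\<C>\<subseteq>\<U>. \<C> \<noteq> {} \<and> countable \<C> \<and> Well_order {(U, V). U \<in> \<C> \<and> V \<in> \<C> \<and> U \<subseteq> V} \<longrightarrow> \<Union>\<C> \<in> \<U>) \<and>
    (\<forall>S. S \<subseteq> carrier M \<and> countable S \<longrightarrow> (\<exists>U\<in>\<U>. S \<subseteq> U))"


section \<open>Ordinals below \<open>\<kappa>\<^sup>+\<close> and ladders\<close>

text \<open>
  The ordinals below \<open>\<kappa>\<^sup>+\<close> are the elements of \<open>Field W\<close>, where \<open>W\<close> is the well-order \<^term>\<open>cardSuc \<kappa>\<close>;
  the ordinals below \<open>\<alpha>\<close> are \<^term>\<open>underS W \<alpha>\<close>. The definitions are stated for an arbitrary
  well-order \<open>W\<close>.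
\<close>

definition cofinal_below :: "'o rel \<Rightarrow> 'o \<Rightarrow> 'o set \<Rightarrow> bool"
  where "cofinal_below W \<alpha> C \<longleftrightarrow>
    C \<subseteq> underS W \<alpha> \<and> (\<forall>\<beta>\<in>underS W \<alpha>. \<exists>\<gamma>\<in>C. (\<beta>, \<gamma>) \<in> W)"

definition has_cofinality :: "'o rel \<Rightarrow> 'o \<Rightarrow> 'c rel \<Rightarrow> bool"
  where "has_cofinality W \<alpha> \<mu> \<longleftrightarrow>
    (\<exists>C. cofinal_below W \<alpha> C \<and> |C| =o \<mu>) \<and> (\<forall>C. cofinal_below W \<alpha> C \<longrightarrow> \<mu> \<le>o |C| )"

definition cof_omega :: "'o rel \<Rightarrow> 'o set"
  where "cof_omega W = {\<alpha> \<in> Field W. has_cofinality W \<alpha> natLeq}"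

text \<open>The last clause says \<open>s \<nu> i = \<tau> + i + 1\<close> with \<open>\<tau>\<close> a limit ordinal or \<open>0\<close>; the library's
  \<^const>\<open>wo_rel.isLim\<close> means ``not a successor'' and so includes \<open>0\<close>.\<close>

definition ladder_system :: "'o rel \<Rightarrow> ('o \<Rightarrow> nat \<Rightarrow> 'o) \<Rightarrow> bool"
  where "ladder_system W s \<longleftrightarrow>
    (\<forall>\<nu>\<in>cof_omega W.
      (\<forall>i j. i < j \<longrightarrow> s \<nu> i \<in> underS W (s \<nu> j)) \<and>
      (\<forall>i. s \<nu> i \<in> underS W \<nu>) \<and>
      wo_rel.supr W (range (s \<nu>)) = \<nu> \<and>
      (\<forall>i. \<exists>\<tau>\<in>Field W. wo_rel.isLim W \<tau> \<and> s \<nu> i = (wo_rel.succ W ^^ (i + 1)) \<tau>))"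

definition ladder_free :: "'o rel \<Rightarrow> ('o \<Rightarrow> nat \<Rightarrow> 'o) \<Rightarrow> 'o set"
  where "ladder_free W s = {\<beta> \<in> Field W. \<beta> \<notin> cof_omega W \<union> (\<Union>\<alpha>\<in>cof_omega W. range (s \<alpha>))}"


section \<open>The modules \<open>P\<close>, \<open>G\<close>, \<open>M\<close> and \<open>M\<^sub>A\<close>\<close>

text \<open>
  \<open>P\<close> is the direct sum of copies of \<open>F\<close> with one summand \<open>Off \<beta>\<close> for each \<open>\<beta> \<notin> E\<close> and summands
  \<open>On \<alpha> i\<close> (\<open>i < \<omega>\<close>) for each \<open>\<alpha> \<in> E\<close>. The submodule \<open>F\<^sub>\<alpha>\<close> of \<open>P\<close> consists of the elements supported
  in \<open>block W \<alpha>\<close>.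
\<close>

datatype 'o summand = Off 'o | On 'o nat

definition block :: "'o rel \<Rightarrow> 'o \<Rightarrow> 'o summand set"
  where "block W \<alpha> = (if \<alpha> \<in> cof_omega W then range (On \<alpha>) else {Off \<alpha>})"

definition summands :: "'o rel \<Rightarrow> 'o summand set"
  where "summands W = (\<Union>\<alpha>\<in>Field W. block W \<alpha>)"

definition P_module ::
  "('r, 'f, 'b) module_scheme \<Rightarrow> 'o rel \<Rightarrow> ('r, 'o summand \<Rightarrow> 'f) module"
  where "P_module F W = direct_sum (summands W) (\<lambda>_. F)"

definition P_copy ::
  "('r, 'f, 'b) module_scheme \<Rightarrow> 'o rel \<Rightarrow> 'o summand \<Rightarrow> 'f \<Rightarrow> ('o summand \<Rightarrow> 'f)"
  where "P_copy F W = summand_inj (summands W) (\<lambda>_. F)"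

definition F_part ::
  "('r, 'f, 'b) module_scheme \<Rightarrow> 'o rel \<Rightarrow> 'o set \<Rightarrow> ('o summand \<Rightarrow> 'f) set"
  where "F_part F W A =
    {p \<in> carrier (P_module F W). \<forall>j\<in>summands W. j \<notin> (\<Union>\<alpha>\<in>A. block W \<alpha>) \<longrightarrow> p j = \<zero>\<^bsub>F\<^esub>}"

definition g_image ::
  "('r, 'f, 'b) module_scheme \<Rightarrow> (nat \<Rightarrow> 'f \<Rightarrow> 'f) \<Rightarrow> 'o rel \<Rightarrow> ('o \<Rightarrow> nat \<Rightarrow> 'o) \<Rightarrow> 'o \<Rightarrow> nat \<Rightarrow>
    ('o summand \<Rightarrow> 'f) set"
  where "g_image F f W s \<alpha> i =
    {(P_copy F W (Off (s \<alpha> i)) x \<ominus>\<^bsub>P_module F W\<^esub> P_copy F W (On \<alpha> i) x)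
       \<oplus>\<^bsub>P_module F W\<^esub> P_copy F W (On \<alpha> (i + 1)) (f i x) |x. x \<in> carrier F}"

text \<open>The internal direct sums \<open>G\<^sub>\<alpha> = \<Oplus>\<^sub>i Im g\<^sub>\<alpha>\<^sub>i\<close> and \<open>G = \<Oplus>\<^sub>\<alpha> G\<^sub>\<alpha>\<close> are, as submodules of \<open>P\<close>, the
  sums of their summands, i.e. the submodules generated by the respective unions.\<close>

definition G_part ::
  "('r, 'a) ring_scheme \<Rightarrow> ('r, 'f, 'b) module_scheme \<Rightarrow> (nat \<Rightarrow> 'f \<Rightarrow> 'f) \<Rightarrow>
    'o rel \<Rightarrow> ('o \<Rightarrow> nat \<Rightarrow> 'o) \<Rightarrow> 'o \<Rightarrow> ('o summand \<Rightarrow> 'f) set"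
  where "G_part R F f W s \<alpha> = submodule_span R (P_module F W) (\<Union>i. g_image F f W s \<alpha> i)"

definition G_sub ::
  "('r, 'a) ring_scheme \<Rightarrow> ('r, 'f, 'b) module_scheme \<Rightarrow> (nat \<Rightarrow> 'f \<Rightarrow> 'f) \<Rightarrow>
    'o rel \<Rightarrow> ('o \<Rightarrow> nat \<Rightarrow> 'o) \<Rightarrow> ('o summand \<Rightarrow> 'f) set"
  where "G_sub R F f W s =
    submodule_span R (P_module F W) (\<Union>\<alpha>\<in>cof_omega W. G_part R F f W s \<alpha>)"

definition M_module ::
  "('r, 'a) ring_scheme \<Rightarrow> ('r, 'f, 'b) module_scheme \<Rightarrow> (nat \<Rightarrow> 'f \<Rightarrow> 'f) \<Rightarrow>
    'o rel \<Rightarrow> ('o \<Rightarrow> nat \<Rightarrow> 'o) \<Rightarrow> ('r, ('o summand \<Rightarrow> 'f) set) module"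
  where "M_module R F f W s = quotient_module (P_module F W) (G_sub R F f W s)"

definition M_part ::
  "('r, 'a) ring_scheme \<Rightarrow> ('r, 'f, 'b) module_scheme \<Rightarrow> (nat \<Rightarrow> 'f \<Rightarrow> 'f) \<Rightarrow>
    'o rel \<Rightarrow> ('o \<Rightarrow> nat \<Rightarrow> 'o) \<Rightarrow> 'o set \<Rightarrow> ('o summand \<Rightarrow> 'f) set set"
  where "M_part R F f W s A =
    (\<lambda>p. G_sub R F f W s +>\<^bsub>P_module F W\<^esub> p) ` (F_part F W A <+>\<^bsub>P_module F W\<^esub> G_sub R F f W s)"

end

theory Submission
  imports Defs
begin

text \<open>
  Write \<open>E\<close> for the ordinals of cofinality \<open>\<omega>\<close> and \<open>X\<close> for those that lie neither in \<open>E\<close> nor on a ladder.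
  In \<open>M\<close> the defining relations read
  \<open>x\<^bsub>(s \<alpha> i)\<^esub> = x\<^bsub>(\<alpha>,i)\<^esub> - f\<^sub>i(x)\<^bsub>(\<alpha>,i+1)\<^esub>\<close>. So the copy of \<open>F\<close> at a ladder point already lies in the part
  of \<open>M\<close> that belongs to any \<open>\<alpha> \<in> E\<close> whose ladder passes through that point, and \<open>M\<close> is the sum of the
  \<open>M\<^bsub>{\<alpha>}\<^esub>\<close> with \<open>\<alpha> \<in> E \<union> X\<close>. An element of \<open>P\<close> has finite support, so countably many elements of \<open>M\<close>
  involve only countably many such \<open>\<alpha>\<close>; this is density. Finite supports also give the closure under unions
  of countable chains: the union is \<open>M\<^bsub>B\<^esub>\<close>, where \<open>B\<close> is the union of the index sets, since every generator
  of \<open>M\<^bsub>B\<^esub>\<close> lies in a member of the chain.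

  The substance of the theorem is that \<open>M\<^bsub>A\<^esub>\<close> is a countable direct sum of copies of \<open>F\<close> when
  \<open>A \<subseteq> E \<union> X\<close> is countable. Enumerate \<open>A\<close>. Ladders of different ordinals have
  different suprema, so two of them meet in a finite set (\<open>ladder_system_almost_disjoint\<close>), and for
  \<open>\<alpha> \<in> A \<inter> E\<close> only finitely many points \<open>s \<alpha> i\<close> lie on ladders of earlier members of \<open>A\<close>. At such an \<open>i\<close>
  the relation, read modulo the earlier members, is \<open>x\<^bsub>(\<alpha>,i)\<^esub> = f\<^sub>i(x)\<^bsub>(\<alpha>,i+1)\<^esub>\<close> and expresses
  \<open>F\<^bsub>\<alpha>,i\<^esub>\<close> through \<open>F\<^bsub>\<alpha>,i+1\<^esub>\<close>; as there are finitely many such \<open>i\<close>, the elimination stops. At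
  all other \<open>i\<close> the relation only says what the copy of \<open>F\<close> at a new ladder point is, and constrains nothing
  in \<open>M\<^bsub>A\<^esub>\<close>. Hence the copies \<open>F\<^bsub>\<alpha>,i\<^esub>\<close> that are not eliminated, together with the \<open>F\<^sub>\<beta>\<close> for
  \<open>\<beta> \<in> A \<inter> X\<close>, generate \<open>M\<^bsub>A\<^esub>\<close> (\<open>basis_generates\<close>).

  They are also independent (\<open>G_inter_basis\<close>), by a leading-term argument on a
  nonempty finite sum of elements \<open>g \<alpha> i x\<close> with \<open>x \<noteq> 0\<close>. For each \<open>\<alpha>\<close> that occurs, take the least \<open>i\<close> with which
  it occurs; the \<open>(\<alpha>,i)\<close> component of the sum is then \<open>-x \<noteq> 0\<close>, so if the sum is supported in the
  basis, \<open>(\<alpha>,i)\<close> is a basis position. For the last \<open>\<alpha>\<close> that occurs, the ladder point \<open>s \<alpha> i\<close> is then on no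
  other ladder that occurs, so the sum has the nonzero component \<open>x\<close> there; but ladder points are not basis
  positions.
\<close>

section \<open>Submodules of right modules\<close>

context right_module
begin

lemma smult_zero_left:
  assumes "x \<in> carrier M" shows "\<zero> \<odot>\<^bsub>M\<^esub> x = \<zero>\<^bsub>M\<^esub>"
proof -
  have "\<zero> \<odot>\<^bsub>M\<^esub> x \<oplus>\<^bsub>M\<^esub> \<zero> \<odot>\<^bsub>M\<^esub> x = \<zero> \<odot>\<^bsub>M\<^esub> x"
    using smult_l_distr[of \<zero> \<zero> x] assms by simp
  then show ?thesis
    using M.add.l_cancel_one smult_closed[of \<zero> x] assms by simp
qed

lemma smult_zero_right:
  assumes "r \<in> carrier R" shows "r \<odot>\<^bsub>M\<^esub> \<zero>\<^bsub>M\<^esub> = \<zero>\<^bsub>M\<^esub>"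
proof -
  have "r \<odot>\<^bsub>M\<^esub> \<zero>\<^bsub>M\<^esub> \<oplus>\<^bsub>M\<^esub> r \<odot>\<^bsub>M\<^esub> \<zero>\<^bsub>M\<^esub> = r \<odot>\<^bsub>M\<^esub> \<zero>\<^bsub>M\<^esub>"
    using smult_r_distr[of r "\<zero>\<^bsub>M\<^esub>" "\<zero>\<^bsub>M\<^esub>"] assms by simp
  then show ?thesis
    using M.add.l_cancel_one smult_closed[of r "\<zero>\<^bsub>M\<^esub>"] assms by simp
qed

lemma smult_minus_one:
  assumes "x \<in> carrier M" shows "(\<ominus> \<one>) \<odot>\<^bsub>M\<^esub> x = \<ominus>\<^bsub>M\<^esub> x"
proof -
  have "(\<ominus> \<one>) \<odot>\<^bsub>M\<^esub> x \<oplus>\<^bsub>M\<^esub> x = (\<ominus> \<one> \<oplus> \<one>) \<odot>\<^bsub>M\<^esub> x"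
    using smult_l_distr[of "\<ominus> \<one>" \<one> x] assms smult_one by simp
  also have "\<dots> = \<zero>\<^bsub>M\<^esub>"
    using assms smult_zero_left R.l_neg by simp
  finally show ?thesis
    using M.minus_equality smult_closed[of "\<ominus> \<one>" x] assms by simp
qed

text \<open>Closure under additive inverses is automatic, because \<open>- x = x (-1)\<close>.\<close>

lemma submoduleI_right:
  assumes "H \<subseteq> carrier M" and "\<zero>\<^bsub>M\<^esub> \<in> H"
    and "\<And>x y. \<lbrakk>x \<in> H; y \<in> H\<rbrakk> \<Longrightarrow> x \<oplus>\<^bsub>M\<^esub> y \<in> H"
    and "\<And>r x. \<lbrakk>r \<in> carrier R; x \<in> H\<rbrakk> \<Longrightarrow> r \<odot>\<^bsub>M\<^esub> x \<in> H"
  shows "submodule H R M"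
proof -
  have "\<ominus>\<^bsub>M\<^esub> x \<in> H" if "x \<in> H" for x
    using that assms(1) assms(4)[of "\<ominus> \<one>" x] smult_minus_one[of x] by auto
  with assms show ?thesis
    by (intro submodule.intro subgroup.intro) (auto simp: submodule_axioms_def a_inv_def)
qed

lemma
  assumes "submodule H R M"
  shows submodule_subset: "H \<subseteq> carrier M"
    and submodule_zero: "\<zero>\<^bsub>M\<^esub> \<in> H"
    and submodule_add: "\<And>x y. \<lbrakk>x \<in> H; y \<in> H\<rbrakk> \<Longrightarrow> x \<oplus>\<^bsub>M\<^esub> y \<in> H"
    and submodule_smult: "\<And>r x. \<lbrakk>r \<in> carrier R; x \<in> H\<rbrakk> \<Longrightarrow> r \<odot>\<^bsub>M\<^esub> x \<in> H"
    and submodule_uminus: "\<And>x. x \<in> H \<Longrightarrow> \<ominus>\<^bsub>M\<^esub> x \<in> H"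
    and submodule_minus: "\<And>x y. \<lbrakk>x \<in> H; y \<in> H\<rbrakk> \<Longrightarrow> x \<ominus>\<^bsub>M\<^esub> y \<in> H"
proof -
  interpret submodule H R M by fact
  show sub: "H \<subseteq> carrier M" and "\<zero>\<^bsub>M\<^esub> \<in> H"
    and add: "\<And>x y. \<lbrakk>x \<in> H; y \<in> H\<rbrakk> \<Longrightarrow> x \<oplus>\<^bsub>M\<^esub> y \<in> H"
    and "\<And>r x. \<lbrakk>r \<in> carrier R; x \<in> H\<rbrakk> \<Longrightarrow> r \<odot>\<^bsub>M\<^esub> x \<in> H"
    using subset one_closed m_closed by auto
  show um: "\<ominus>\<^bsub>M\<^esub> x \<in> H" if "x \<in> H" for x
    using that m_inv_closed by (simp add: a_inv_def)
  show "x \<ominus>\<^bsub>M\<^esub> y \<in> H" if "x \<in> H" "y \<in> H" for x y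
    using add um that by (simp add: a_minus_def)
qed

lemma carrier_submodule: "submodule (carrier M) R M"
  by (rule submoduleI_right) (auto intro: smult_closed)

lemma submodule_abelian_subgroup:
  assumes "submodule H R M" shows "abelian_subgroup H M"
  using assms abelian_subgroupI3[OF additive_subgroupI M.abelian_group_axioms]
  by (simp add: submodule_def)

lemma submodule_span_submodule:
  assumes "S \<subseteq> carrier M" shows "submodule (submodule_span R M S) R M"
proof -
  have "submodule (\<Inter>{U. submodule U R M \<and> S \<subseteq> U}) R M"
  proof (rule submoduleI_right)
    show "\<Inter>{U. submodule U R M \<and> S \<subseteq> U} \<subseteq> carrier M"
      using carrier_submodule assms by blast
  qed (auto intro: submodule_zero submodule_add submodule_smult)
  then show ?thesis
    by (simp add: submodule_span_def hull_def)
qed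

lemma set_addI: "\<lbrakk>h \<in> H; k \<in> K\<rbrakk> \<Longrightarrow> h \<oplus>\<^bsub>M\<^esub> k \<in> H <+>\<^bsub>M\<^esub> K"
  by (auto simp: set_add_def')

lemma submodule_set_add:
  assumes H: "submodule H R M" and K: "submodule K R M"
  shows "submodule (H <+>\<^bsub>M\<^esub> K) R M"
proof (rule submoduleI_right)
  note sub = subsetD[OF submodule_subset[OF H]] subsetD[OF submodule_subset[OF K]]
  show "H <+>\<^bsub>M\<^esub> K \<subseteq> carrier M"
    by (auto simp: set_add_def' dest: sub)
  show "\<zero>\<^bsub>M\<^esub> \<in> H <+>\<^bsub>M\<^esub> K"
    using set_addI[OF submodule_zero[OF H] submodule_zero[OF K]] by simp
  show "x \<oplus>\<^bsub>M\<^esub> y \<in> H <+>\<^bsub>M\<^esub> K" if "x \<in> H <+>\<^bsub>M\<^esub> K" "y \<in> H <+>\<^bsub>M\<^esub> K" for x y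
  proof -
    from that obtain h k h' k' where *: "h \<in> H" "k \<in> K" "h' \<in> H" "k' \<in> K"
      and "x = h \<oplus>\<^bsub>M\<^esub> k" "y = h' \<oplus>\<^bsub>M\<^esub> k'"
      by (auto simp: set_add_def')
    then have "x \<oplus>\<^bsub>M\<^esub> y = (h \<oplus>\<^bsub>M\<^esub> h') \<oplus>\<^bsub>M\<^esub> (k \<oplus>\<^bsub>M\<^esub> k')"
      using sub by (simp add: M.a_ac)
    then show ?thesis
      using * by (simp add: set_addI submodule_add[OF H] submodule_add[OF K])
  qed
  show "r \<odot>\<^bsub>M\<^esub> x \<in> H <+>\<^bsub>M\<^esub> K" if "r \<in> carrier R" "x \<in> H <+>\<^bsub>M\<^esub> K" for r x
  proof -
    from that obtain h k where *: "h \<in> H" "k \<in> K" and "x = h \<oplus>\<^bsub>M\<^esub> k"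
      by (auto simp: set_add_def')
    then have "r \<odot>\<^bsub>M\<^esub> x = r \<odot>\<^bsub>M\<^esub> h \<oplus>\<^bsub>M\<^esub> r \<odot>\<^bsub>M\<^esub> k"
      using sub that smult_r_distr by simp
    then show ?thesis
      using * that by (simp add: set_addI submodule_smult[OF H] submodule_smult[OF K])
  qed
qed

lemma submodule_set_addD:
  assumes H: "submodule H R M" and K: "submodule K R M"
  shows "H \<subseteq> H <+>\<^bsub>M\<^esub> K" and "K \<subseteq> H <+>\<^bsub>M\<^esub> K"
proof -
  have "h \<in> H <+>\<^bsub>M\<^esub> K" if "h \<in> H" for h
    using set_addI[OF that submodule_zero[OF K]] that submodule_subset[OF H] by auto
  moreover have "k \<in> H <+>\<^bsub>M\<^esub> K" if "k \<in> K" for k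
    using set_addI[OF submodule_zero[OF H] that] that submodule_subset[OF K] by auto
  ultimately show "H \<subseteq> H <+>\<^bsub>M\<^esub> K" and "K \<subseteq> H <+>\<^bsub>M\<^esub> K" by auto
qed

lemma submodule_right_module:
  assumes H: "submodule H R M" shows "right_module R (M\<lparr>carrier := H\<rparr>)"
proof -
  note sub = subsetD[OF submodule_subset[OF H]]
  have "abelian_group (M\<lparr>carrier := H\<rparr>)"
  proof (rule abelian_groupI)
    fix x assume x: "x \<in> carrier (M\<lparr>carrier := H\<rparr>)"
    show "\<exists>y\<in>carrier (M\<lparr>carrier := H\<rparr>). y \<oplus>\<^bsub>M\<lparr>carrier := H\<rparr>\<^esub> x = \<zero>\<^bsub>M\<lparr>carrier := H\<rparr>\<^esub>"
      using x sub submodule_uminus[OF H] M.l_neg by auto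
  qed (use sub in \<open>auto intro: submodule_add[OF H] submodule_zero[OF H] M.a_ac\<close>)
  then show ?thesis
    by (intro right_module.intro right_module_axioms.intro R.ring_axioms)
       (use sub in \<open>auto intro: submodule_smult[OF H] smult_l_distr smult_r_distr smult_assoc smult_one\<close>)
qed

end

section \<open>Homomorphisms\<close>

lemma right_module_homD:
  assumes "h \<in> right_module_hom R M N"
  shows "x \<in> carrier M \<Longrightarrow> h x \<in> carrier N"
    and "\<lbrakk>x \<in> carrier M; y \<in> carrier M\<rbrakk> \<Longrightarrow> h (x \<oplus>\<^bsub>M\<^esub> y) = h x \<oplus>\<^bsub>N\<^esub> h y"
    and "\<lbrakk>r \<in> carrier R; x \<in> carrier M\<rbrakk> \<Longrightarrow> h (r \<odot>\<^bsub>M\<^esub> x) = r \<odot>\<^bsub>N\<^esub> h x"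
  using assms by (auto simp: right_module_hom_def)

lemma right_module_hom_zero:
  assumes "right_module R M" "right_module R N" "h \<in> right_module_hom R M N"
  shows "h \<zero>\<^bsub>M\<^esub> = \<zero>\<^bsub>N\<^esub>"
proof -
  interpret M: right_module R M by fact
  interpret N: right_module R N by fact
  have "h \<zero>\<^bsub>M\<^esub> \<oplus>\<^bsub>N\<^esub> h \<zero>\<^bsub>M\<^esub> = h \<zero>\<^bsub>M\<^esub>"
    using right_module_homD(2)[OF assms(3), of "\<zero>\<^bsub>M\<^esub>" "\<zero>\<^bsub>M\<^esub>"] by simp
  then show ?thesis
    using N.M.add.l_cancel_one right_module_homD(1)[OF assms(3), of "\<zero>\<^bsub>M\<^esub>"] by simp
qed

lemma right_module_hom_uminus:
  assumes "right_module R M" "right_module R N" "h \<in> right_module_hom R M N" "x \<in> carrier M"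
  shows "h (\<ominus>\<^bsub>M\<^esub> x) = \<ominus>\<^bsub>N\<^esub> h x"
proof -
  interpret M: right_module R M by fact
  interpret N: right_module R N by fact
  show ?thesis
    using right_module_homD[OF assms(3)] assms(4)
    by (simp flip: M.smult_minus_one N.smult_minus_one)
qed

lemma right_module_hom_minus:
  assumes "right_module R M" "right_module R N" "h \<in> right_module_hom R M N"
    and "x \<in> carrier M" "y \<in> carrier M"
  shows "h (x \<ominus>\<^bsub>M\<^esub> y) = h x \<ominus>\<^bsub>N\<^esub> h y"
proof -
  interpret M: right_module R M by fact
  show ?thesis
    using right_module_homD(2)[OF assms(3,4)] right_module_hom_uminus[OF assms(1-3)] assms(4,5)
    by (simp add: a_minus_def)
qed

lemma submodule_image:
  assumes "right_module R M" "right_module R N" and h: "h \<in> right_module_hom R M N"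
    and U: "submodule U R M"
  shows "submodule (h ` U) R N"
proof -
  interpret M: right_module R M by fact
  interpret N: right_module R N by fact
  note sub = subsetD[OF M.submodule_subset[OF U]]
  show ?thesis
  proof (rule N.submoduleI_right)
    show "h ` U \<subseteq> carrier N" using sub right_module_homD(1)[OF h] by auto
    show "\<zero>\<^bsub>N\<^esub> \<in> h ` U"
      using right_module_hom_zero[OF assms(1-3)] M.submodule_zero[OF U] by force
    show "x \<oplus>\<^bsub>N\<^esub> y \<in> h ` U" if "x \<in> h ` U" "y \<in> h ` U" for x y
      using that sub by (auto simp flip: right_module_homD(2)[OF h] intro: M.submodule_add[OF U])
    show "r \<odot>\<^bsub>N\<^esub> x \<in> h ` U" if "r \<in> carrier R" "x \<in> h ` U" for r x
      using that sub by (auto simp flip: right_module_homD(3)[OF h] intro: M.submodule_smult[OF U])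
  qed
qed

lemma right_module_isomorphic_sym:
  assumes "right_module R M" and "right_module_isomorphic R M N"
  shows "right_module_isomorphic R N M"
proof -
  interpret M: right_module R M by fact
  obtain h where h: "h \<in> right_module_hom R M N" and bij: "bij_betw h (carrier M) (carrier N)"
    using assms(2) by (auto simp: right_module_isomorphic_def)
  let ?g = "inv_into (carrier M) h"
  have g: "?g y \<in> carrier M" "h (?g y) = y" if "y \<in> carrier N" for y
    using that bij by (auto simp: bij_betw_def inv_into_into f_inv_into_f)
  have eq: "?g y = x" if "x \<in> carrier M" "h x = y" for x y
    using that bij by (auto simp: bij_betw_def)
  have "?g \<in> right_module_hom R N M"
    unfolding right_module_hom_def
    using g by (auto intro!: eq M.smult_closed simp: right_module_homD[OF h])
  then show ?thesis
    using bij_betw_inv_into[OF bij] by (auto simp: right_module_isomorphic_def)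
qed

section \<open>Quotient modules\<close>

context right_module
begin

lemma quotient_module_coset_eq_iff:
  assumes H: "submodule H R M" and x: "x \<in> carrier M" and y: "y \<in> carrier M"
  shows "H +>\<^bsub>M\<^esub> x = H +>\<^bsub>M\<^esub> y \<longleftrightarrow> x \<ominus>\<^bsub>M\<^esub> y \<in> H"
proof -
  interpret H: abelian_subgroup H M by (rule submodule_abelian_subgroup[OF H])
  show ?thesis
    using H.a_rcos_module[OF y x] H.a_repr_independence'[OF _ y] H.a_repr_independenceD[OF x]
    by (auto simp: a_minus_def)
qed

text \<open>
  The scalar multiple of a coset is defined as a union over all representatives; every representative
  contributes the same coset.
\<close>

lemma quotient_module_smult_coset:
  assumes H: "submodule H R M" and x: "x \<in> carrier M" and r: "r \<in> carrier R"
  shows "r \<odot>\<^bsub>quotient_module M H\<^esub> (H +>\<^bsub>M\<^esub> x) = H +>\<^bsub>M\<^esub> (r \<odot>\<^bsub>M\<^esub> x)"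
proof -
  interpret H: abelian_subgroup H M by (rule submodule_abelian_subgroup[OF H])
  have "H +>\<^bsub>M\<^esub> (r \<odot>\<^bsub>M\<^esub> y) = H +>\<^bsub>M\<^esub> (r \<odot>\<^bsub>M\<^esub> x)" if "y \<in> H +>\<^bsub>M\<^esub> x" for y
  proof -
    from that obtain h where h: "h \<in> H" and y: "y = h \<oplus>\<^bsub>M\<^esub> x"
      by (auto simp: a_r_coset_def')
    have [simp]: "h \<in> carrier M" using h by (rule H.a_Hcarr)
    have "r \<odot>\<^bsub>M\<^esub> y \<ominus>\<^bsub>M\<^esub> r \<odot>\<^bsub>M\<^esub> x = r \<odot>\<^bsub>M\<^esub> h"
      using x r h y by (simp add: smult_r_distr smult_closed a_minus_def M.a_assoc M.r_neg)
    then show ?thesis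
      using x r h y by (simp add: quotient_module_coset_eq_iff[OF H] smult_closed submodule_smult[OF H])
  qed
  moreover have "x \<in> H +>\<^bsub>M\<^esub> x" by (rule H.a_rcos_self[OF x])
  ultimately have "(\<Union>y\<in>H +>\<^bsub>M\<^esub> x. H +>\<^bsub>M\<^esub> (r \<odot>\<^bsub>M\<^esub> y)) = H +>\<^bsub>M\<^esub> (r \<odot>\<^bsub>M\<^esub> x)"
    by blast
  then show ?thesis
    by (simp add: quotient_module_def)
qed

lemma quotient_module_carrier:
  "carrier (quotient_module M H) = (\<lambda>x. H +>\<^bsub>M\<^esub> x) ` carrier M"
  by (auto simp: quotient_module_def A_RCOSETS_def')

lemma quotient_module_right_module:
  assumes H: "submodule H R M"
  shows "right_module R (quotient_module M H)"
    and "(\<lambda>x. H +>\<^bsub>M\<^esub> x) \<in> right_module_hom R M (quotient_module M H)"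
proof -
  interpret H: abelian_subgroup H M by (rule submodule_abelian_subgroup[OF H])
  let ?Q = "quotient_module M H"
  have add: "(H +>\<^bsub>M\<^esub> x) \<oplus>\<^bsub>?Q\<^esub> (H +>\<^bsub>M\<^esub> y) = H +>\<^bsub>M\<^esub> (x \<oplus>\<^bsub>M\<^esub> y)"
    if "x \<in> carrier M" "y \<in> carrier M" for x y
    using that H.a_rcos_sum by (simp add: quotient_module_def)
  have zero: "\<zero>\<^bsub>?Q\<^esub> = H +>\<^bsub>M\<^esub> \<zero>\<^bsub>M\<^esub>"
    using M.a_coset_add_zero[OF submodule_subset[OF H]] by (simp add: quotient_module_def)
  note smult = quotient_module_smult_coset[OF H]
  have "abelian_group ?Q"
  proof (rule abelian_groupI, unfold quotient_module_carrier)
    show "\<exists>y\<in>(+>\<^bsub>M\<^esub>) H ` carrier M. y \<oplus>\<^bsub>?Q\<^esub> x = \<zero>\<^bsub>?Q\<^esub>" if "x \<in> (+>\<^bsub>M\<^esub>) H ` carrier M" for x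
    proof -
      from that obtain a where a: "a \<in> carrier M" "x = H +>\<^bsub>M\<^esub> a" by auto
      then have "(H +>\<^bsub>M\<^esub> (\<ominus>\<^bsub>M\<^esub> a)) \<oplus>\<^bsub>?Q\<^esub> x = \<zero>\<^bsub>?Q\<^esub>"
        by (simp add: add zero M.l_neg)
      then show ?thesis using a by blast
    qed
  qed (auto simp: add zero M.a_ac)
  then show "right_module R ?Q"
    by (intro right_module.intro right_module_axioms.intro R.ring_axioms, unfold quotient_module_carrier)
       (auto simp: add smult smult_closed smult_l_distr smult_r_distr smult_assoc smult_one)
  show "(\<lambda>x. H +>\<^bsub>M\<^esub> x) \<in> right_module_hom R M ?Q"
    by (auto simp: right_module_hom_def quotient_module_carrier add smult)
qed

text \<open>This turns a statement about generators modulo \<open>H\<close> into one about images in the quotient.\<close>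

lemma coset_image_set_add:
  assumes H: "submodule H R M" and V: "submodule V R M"
  shows "(\<lambda>x. H +>\<^bsub>M\<^esub> x) ` (V <+>\<^bsub>M\<^esub> H) = (\<lambda>x. H +>\<^bsub>M\<^esub> x) ` V"
proof
  note sub = subsetD[OF submodule_subset[OF H]] subsetD[OF submodule_subset[OF V]]
  have "H +>\<^bsub>M\<^esub> (v \<oplus>\<^bsub>M\<^esub> h) = H +>\<^bsub>M\<^esub> v" if "v \<in> V" "h \<in> H" for v h
  proof -
    have "(v \<oplus>\<^bsub>M\<^esub> h) \<ominus>\<^bsub>M\<^esub> v = h"
      using sub that by (simp add: a_minus_def M.a_comm[of v] M.a_assoc M.r_neg)
    then show ?thesis
      using sub that by (simp add: quotient_module_coset_eq_iff[OF H])
  qed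
  then show "(\<lambda>x. H +>\<^bsub>M\<^esub> x) ` (V <+>\<^bsub>M\<^esub> H) \<subseteq> (\<lambda>x. H +>\<^bsub>M\<^esub> x) ` V"
    by (auto simp: set_add_def')
  show "(\<lambda>x. H +>\<^bsub>M\<^esub> x) ` V \<subseteq> (\<lambda>x. H +>\<^bsub>M\<^esub> x) ` (V <+>\<^bsub>M\<^esub> H)"
    using submodule_set_addD(1)[OF V H] by (rule image_mono)
qed

end

section \<open>Direct sums\<close>

lemma direct_sum_carrier:
  "p \<in> carrier (direct_sum I D) \<longleftrightarrow>
    p \<in> (\<Pi>\<^sub>E i\<in>I. carrier (D i)) \<and> finite {i \<in> I. p i \<noteq> \<zero>\<^bsub>D i\<^esub>}"
  by (simp add: direct_sum_def)

lemma direct_sum_apply: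
  assumes "i \<in> I"
  shows "(p \<oplus>\<^bsub>direct_sum I D\<^esub> q) i = p i \<oplus>\<^bsub>D i\<^esub> q i"
    and "(r \<odot>\<^bsub>direct_sum I D\<^esub> p) i = r \<odot>\<^bsub>D i\<^esub> p i"
    and "\<zero>\<^bsub>direct_sum I D\<^esub> i = \<zero>\<^bsub>D i\<^esub>"
  using assms by (simp_all add: direct_sum_def)

lemma direct_sum_eqI:
  assumes "p \<in> carrier (direct_sum I D)" "q \<in> carrier (direct_sum I D)"
    and "\<And>i. i \<in> I \<Longrightarrow> p i = q i"
  shows "p = q"
  using assms by (auto simp: direct_sum_carrier intro: PiE_ext)

lemma direct_sum_component:
  assumes "p \<in> carrier (direct_sum I D)" "i \<in> I"
  shows "p i \<in> carrier (D i)"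
  using assms by (auto simp: direct_sum_carrier)

lemma direct_sum_right_module:
  assumes "ring R" and D: "\<And>i. i \<in> I \<Longrightarrow> right_module R (D i)"
  shows "right_module R (direct_sum I D)"
proof -
  let ?S = "direct_sum I D"
  interpret R: ring R by fact
  note ab = right_module.axioms(2)[OF D]
  note mon = abelian_group.axioms(1)[OF ab]
  have zero: "\<zero>\<^bsub>?S\<^esub> \<in> carrier ?S"
    by (auto simp: direct_sum_def intro: abelian_monoid.zero_closed[OF mon])
  have add: "p \<oplus>\<^bsub>?S\<^esub> q \<in> carrier ?S" if p: "p \<in> carrier ?S" and q: "q \<in> carrier ?S" for p q
  proof -
    have "{i \<in> I. p i \<oplus>\<^bsub>D i\<^esub> q i \<noteq> \<zero>\<^bsub>D i\<^esub>} \<subseteq> {i \<in> I. p i \<noteq> \<zero>\<^bsub>D i\<^esub>} \<union> {i \<in> I. q i \<noteq> \<zero>\<^bsub>D i\<^esub>}"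
      using abelian_monoid.l_zero[OF mon] abelian_monoid.zero_closed[OF mon] by auto
    with p q have "finite {i \<in> I. p i \<oplus>\<^bsub>D i\<^esub> q i \<noteq> \<zero>\<^bsub>D i\<^esub>}"
      by (auto simp: direct_sum_carrier intro: finite_subset)
    moreover have "p i \<oplus>\<^bsub>D i\<^esub> q i \<in> carrier (D i)" if "i \<in> I" for i
      using direct_sum_component[OF p] direct_sum_component[OF q] abelian_monoid.a_closed[OF mon] that
      by blast
    ultimately show ?thesis
      by (auto simp: direct_sum_def cong: conj_cong)
  qed
  have smult: "r \<odot>\<^bsub>?S\<^esub> p \<in> carrier ?S" if p: "p \<in> carrier ?S" and r: "r \<in> carrier R" for p r
  proof -
    have "{i \<in> I. r \<odot>\<^bsub>D i\<^esub> p i \<noteq> \<zero>\<^bsub>D i\<^esub>} \<subseteq> {i \<in> I. p i \<noteq> \<zero>\<^bsub>D i\<^esub>}"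
      using right_module.smult_zero_right[OF D] r by force
    with p have "finite {i \<in> I. r \<odot>\<^bsub>D i\<^esub> p i \<noteq> \<zero>\<^bsub>D i\<^esub>}"
      by (auto simp: direct_sum_carrier intro: finite_subset)
    moreover have "r \<odot>\<^bsub>D i\<^esub> p i \<in> carrier (D i)" if "i \<in> I" for i
      using direct_sum_component[OF p] right_module.smult_closed[OF D] that r by blast
    ultimately show ?thesis
      by (auto simp: direct_sum_def cong: conj_cong)
  qed
  have neg: "\<exists>q\<in>carrier ?S. q \<oplus>\<^bsub>?S\<^esub> p = \<zero>\<^bsub>?S\<^esub>" if p: "p \<in> carrier ?S" for p
  proof (rule bexI)
    show q: "(\<ominus>\<^bsub>R\<^esub> \<one>\<^bsub>R\<^esub>) \<odot>\<^bsub>?S\<^esub> p \<in> carrier ?S" using smult p by simp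
    show "(\<ominus>\<^bsub>R\<^esub> \<one>\<^bsub>R\<^esub>) \<odot>\<^bsub>?S\<^esub> p \<oplus>\<^bsub>?S\<^esub> p = \<zero>\<^bsub>?S\<^esub>"
      using direct_sum_component[OF p]
      by (intro direct_sum_eqI[OF add[OF q p] zero])
         (simp add: direct_sum_apply right_module.smult_minus_one[OF D] abelian_group.l_neg[OF ab])
  qed
  note comp = direct_sum_component direct_sum_apply
  have "abelian_group ?S"
  proof (rule abelian_groupI)
    show "p \<oplus>\<^bsub>?S\<^esub> q \<oplus>\<^bsub>?S\<^esub> u = p \<oplus>\<^bsub>?S\<^esub> (q \<oplus>\<^bsub>?S\<^esub> u)"
      if "p \<in> carrier ?S" "q \<in> carrier ?S" "u \<in> carrier ?S" for p q u
      by (rule direct_sum_eqI[of _ I D])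
         (use that in \<open>auto intro: add simp: comp abelian_monoid.a_assoc[OF mon]\<close>)
    show "p \<oplus>\<^bsub>?S\<^esub> q = q \<oplus>\<^bsub>?S\<^esub> p" if "p \<in> carrier ?S" "q \<in> carrier ?S" for p q
      by (rule direct_sum_eqI[of _ I D])
         (use that in \<open>auto intro: add simp: comp abelian_monoid.a_comm[OF mon]\<close>)
    show "\<zero>\<^bsub>?S\<^esub> \<oplus>\<^bsub>?S\<^esub> p = p" if "p \<in> carrier ?S" for p
      by (rule direct_sum_eqI[of _ I D])
         (use that in \<open>auto intro: add zero simp: comp abelian_monoid.l_zero[OF mon]\<close>)
  qed (auto intro: add zero neg)
  moreover have "right_module_axioms R ?S"
  proof
    show "r \<odot>\<^bsub>?S\<^esub> p \<in> carrier ?S" if "r \<in> carrier R" "p \<in> carrier ?S" for r p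
      using smult that by blast
    show "(r \<oplus>\<^bsub>R\<^esub> t) \<odot>\<^bsub>?S\<^esub> p = r \<odot>\<^bsub>?S\<^esub> p \<oplus>\<^bsub>?S\<^esub> t \<odot>\<^bsub>?S\<^esub> p"
      if "r \<in> carrier R" "t \<in> carrier R" "p \<in> carrier ?S" for r t p
      by (rule direct_sum_eqI[of _ I D])
         (use that in \<open>auto intro: add smult simp: comp right_module.smult_l_distr[OF D]\<close>)
    show "r \<odot>\<^bsub>?S\<^esub> (p \<oplus>\<^bsub>?S\<^esub> q) = r \<odot>\<^bsub>?S\<^esub> p \<oplus>\<^bsub>?S\<^esub> r \<odot>\<^bsub>?S\<^esub> q"
      if "r \<in> carrier R" "p \<in> carrier ?S" "q \<in> carrier ?S" for r p q
      by (rule direct_sum_eqI[of _ I D])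
         (use that in \<open>auto intro: add smult simp: comp right_module.smult_r_distr[OF D]\<close>)
    show "(r \<otimes>\<^bsub>R\<^esub> t) \<odot>\<^bsub>?S\<^esub> p = t \<odot>\<^bsub>?S\<^esub> (r \<odot>\<^bsub>?S\<^esub> p)"
      if "r \<in> carrier R" "t \<in> carrier R" "p \<in> carrier ?S" for r t p
      by (rule direct_sum_eqI[of _ I D])
         (use that in \<open>auto intro: smult simp: comp right_module.smult_assoc[OF D]\<close>)
    show "\<one>\<^bsub>R\<^esub> \<odot>\<^bsub>?S\<^esub> p = p" if "p \<in> carrier ?S" for p
      by (rule direct_sum_eqI[of _ I D])
         (use that in \<open>auto intro: smult simp: comp right_module.smult_one[OF D]\<close>)
  qed
  ultimately show ?thesis
    by (intro right_module.intro assms(1))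
qed

lemma direct_sum_component_hom:
  assumes "i \<in> I" shows "(\<lambda>p. p i) \<in> right_module_hom R (direct_sum I D) (D i)"
  using assms by (simp add: right_module_hom_def direct_sum_apply direct_sum_component[of _ I])

lemma direct_sum_summand_inj:
  assumes "\<And>i. i \<in> I \<Longrightarrow> right_module R (D i)" and "j \<in> I"
  shows "summand_inj I D j \<in> right_module_hom R (D j) (direct_sum I D)"
proof -
  note mon = abelian_group.axioms(1)[OF right_module.axioms(2)[OF assms(1)]]
  have "{i \<in> I. (if i = j then x else \<zero>\<^bsub>D i\<^esub>) \<noteq> \<zero>\<^bsub>D i\<^esub>} \<subseteq> {j}" for x
    by auto
  then have fin: "finite {i \<in> I. (if i = j then x else \<zero>\<^bsub>D i\<^esub>) \<noteq> \<zero>\<^bsub>D i\<^esub>}" for x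
    by (rule finite_subset) simp
  show ?thesis
    using assms(2) fin
    by (auto simp: right_module_hom_def direct_sum_def summand_inj_def fun_eq_iff
        abelian_monoid.zero_closed[OF mon] abelian_monoid.l_zero[OF mon]
        right_module.smult_zero_right[OF assms(1)] cong: conj_cong)
qed

lemma summand_inj_apply:
  "i \<in> I \<Longrightarrow> summand_inj I D j x i = (if i = j then x else \<zero>\<^bsub>D i\<^esub>)"
  by (simp add: summand_inj_def)

text \<open>
  A finitely supported family is the finite sum of its entries, so a submodule that contains the summands
  over the support of \<open>p\<close> contains \<open>p\<close>. The proof peels off one index of the support at a time.
\<close>

lemma direct_sum_in_submodule:
  assumes "ring R" and D: "\<And>i. i \<in> I \<Longrightarrow> right_module R (D i)"
    and V: "submodule V R (direct_sum I D)"
    and gen: "\<And>i x. \<lbrakk>i \<in> I; p i \<noteq> \<zero>\<^bsub>D i\<^esub>; x \<in> carrier (D i)\<rbrakk> \<Longrightarrow> summand_inj I D i x \<in> V"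
    and p: "p \<in> carrier (direct_sum I D)"
  shows "p \<in> V"
proof -
  let ?S = "direct_sum I D"
  interpret S: right_module R ?S by (rule direct_sum_right_module[OF assms(1,2)])
  note ab = right_module.axioms(2)[OF D]
  have "q \<in> V"
    if "finite T" "T \<subseteq> {i \<in> I. p i \<noteq> \<zero>\<^bsub>D i\<^esub>}" "q \<in> carrier ?S" "\<And>i. i \<in> I \<Longrightarrow> i \<notin> T \<Longrightarrow> q i = \<zero>\<^bsub>D i\<^esub>" for T q
    using that
  proof (induction T arbitrary: q rule: finite_induct)
    case empty
    then have "q = \<zero>\<^bsub>?S\<^esub>"
      by (intro direct_sum_eqI[of _ I D]) (auto simp: direct_sum_apply)
    then show ?case using S.submodule_zero[OF V] by simp
  next
    case (insert j T)
    then have j: "j \<in> I" by auto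
    define u where "u = summand_inj I D j (q j)"
    have qj: "q j \<in> carrier (D j)" using direct_sum_component[OF insert.prems(2) j] .
    then have uV: "u \<in> V" using insert.prems(1) by (auto simp: u_def intro: gen)
    have u: "u \<in> carrier ?S" using right_module_homD(1)[OF direct_sum_summand_inj[where D = D, OF D j] qj] by (simp add: u_def)
    have "q \<ominus>\<^bsub>?S\<^esub> u \<in> V"
    proof (rule insert.IH)
      show "q \<ominus>\<^bsub>?S\<^esub> u \<in> carrier ?S" using insert.prems(2) u by simp
      show "(q \<ominus>\<^bsub>?S\<^esub> u) i = \<zero>\<^bsub>D i\<^esub>" if i: "i \<in> I" "i \<notin> T" for i
      proof -
        have "(q \<ominus>\<^bsub>?S\<^esub> u) i = q i \<ominus>\<^bsub>D i\<^esub> u i"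
          using right_module_hom_minus[OF S.right_module_axioms D[OF i(1)] direct_sum_component_hom[OF i(1)]
              insert.prems(2) u] .
        then show ?thesis
          using insert.prems(3)[OF i(1)] i(2) direct_sum_component[OF insert.prems(2) i(1)]
          by (cases "i = j") (simp_all add: u_def summand_inj_apply i(1) j a_minus_def abelian_group.r_neg[OF ab])
      qed
    qed (use insert.prems(1) in auto)
    then have "(q \<ominus>\<^bsub>?S\<^esub> u) \<oplus>\<^bsub>?S\<^esub> u \<in> V"
      using uV by (rule S.submodule_add[OF V])
    moreover have "(q \<ominus>\<^bsub>?S\<^esub> u) \<oplus>\<^bsub>?S\<^esub> u = q"
      using insert.prems(2) u by (simp add: a_minus_def S.M.a_assoc S.M.l_neg)
    ultimately show ?case by simp
  qed
  from this[of "{i \<in> I. p i \<noteq> \<zero>\<^bsub>D i\<^esub>}" p] show ?thesis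
    using p by (auto simp: direct_sum_carrier)
qed

lemma direct_sum_supported_submodule:
  assumes "ring R" and D: "\<And>i. i \<in> I \<Longrightarrow> right_module R (D i)"
  shows "submodule {p \<in> carrier (direct_sum I D). \<forall>i\<in>I. i \<notin> B \<longrightarrow> p i = \<zero>\<^bsub>D i\<^esub>} R (direct_sum I D)"
proof -
  interpret S: right_module R "direct_sum I D" by (rule direct_sum_right_module[OF assms])
  note mon = abelian_group.axioms(1)[OF right_module.axioms(2)[OF D]]
  show ?thesis
    by (rule S.submoduleI_right)
       (auto simp: direct_sum_apply S.smult_closed abelian_monoid.l_zero[OF mon]
         abelian_monoid.zero_closed[OF mon] right_module.smult_zero_right[OF D])
qed

text \<open>
  The elements supported in \<open>B\<close> form a direct sum over \<open>B\<close>. The index set is transported along \<open>e\<close>, so that a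
  countable \<open>B\<close> can be replaced by a set of natural numbers.
\<close>

lemma direct_sum_reindex:
  assumes F: "right_module R F" and B: "B \<subseteq> J" and e: "inj_on e B"
  obtains h where "h \<in> right_module_hom R (direct_sum (e ` B) (\<lambda>_. F)) (direct_sum J (\<lambda>_. F))"
    and "bij_betw h (carrier (direct_sum (e ` B) (\<lambda>_. F)))
      {p \<in> carrier (direct_sum J (\<lambda>_. F)). \<forall>j\<in>J. j \<notin> B \<longrightarrow> p j = \<zero>\<^bsub>F\<^esub>}"
proof
  interpret F: right_module R F by fact
  let ?S = "direct_sum (e ` B) (\<lambda>_. F)" and ?P = "direct_sum J (\<lambda>_. F)"
  let ?h = "\<lambda>q. \<lambda>j\<in>J. if j \<in> B then q (e j) else \<zero>\<^bsub>F\<^esub>"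
  let ?g = "\<lambda>p. \<lambda>n\<in>e ` B. p (inv_into B e n)"
  have h: "?h q \<in> carrier ?P" if q: "q \<in> carrier ?S" for q
  proof -
    have "{j \<in> J. (if j \<in> B then q (e j) else \<zero>\<^bsub>F\<^esub>) \<noteq> \<zero>\<^bsub>F\<^esub>} \<subseteq> {j \<in> B. e j \<in> {n \<in> e ` B. q n \<noteq> \<zero>\<^bsub>F\<^esub>}}"
      by auto
    moreover have "finite {j \<in> B. e j \<in> {n \<in> e ` B. q n \<noteq> \<zero>\<^bsub>F\<^esub>}}"
      using finite_vimage_IntI[OF _ e, of "{n \<in> e ` B. q n \<noteq> \<zero>\<^bsub>F\<^esub>}"] q
      by (simp add: direct_sum_carrier vimage_def Int_def conj_commute)
    ultimately have "finite {j \<in> J. (if j \<in> B then q (e j) else \<zero>\<^bsub>F\<^esub>) \<noteq> \<zero>\<^bsub>F\<^esub>}"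
      by (rule finite_subset)
    then show ?thesis
      using direct_sum_component[OF q] by (auto simp: direct_sum_carrier cong: conj_cong)
  qed
  have g: "?g p \<in> carrier ?S" if p: "p \<in> carrier ?P" for p
  proof -
    have "{n \<in> e ` B. p (inv_into B e n) \<noteq> \<zero>\<^bsub>F\<^esub>} \<subseteq> e ` {j \<in> J. p j \<noteq> \<zero>\<^bsub>F\<^esub>}"
      using B e by auto
    then have "finite {n \<in> e ` B. p (inv_into B e n) \<noteq> \<zero>\<^bsub>F\<^esub>}"
      by (rule finite_subset) (use p in \<open>simp add: direct_sum_carrier\<close>)
    then show ?thesis
      using direct_sum_component[OF p] B e by (auto simp: direct_sum_carrier cong: conj_cong)
  qed
  show "?h \<in> right_module_hom R ?S ?P"
    unfolding right_module_hom_def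
  proof (intro CollectI conjI ballI funcsetI h)
    interpret S: right_module R ?S by (rule direct_sum_right_module[OF F.R.ring_axioms F])
    interpret P: right_module R ?P by (rule direct_sum_right_module[OF F.R.ring_axioms F])
    show "?h (x \<oplus>\<^bsub>?S\<^esub> y) = ?h x \<oplus>\<^bsub>?P\<^esub> ?h y" if "x \<in> carrier ?S" "y \<in> carrier ?S" for x y
      by (rule direct_sum_eqI[of _ J "\<lambda>_. F"], intro h S.M.a_closed that, intro P.M.a_closed h that)
         (simp add: direct_sum_apply)
    show "?h (r \<odot>\<^bsub>?S\<^esub> x) = r \<odot>\<^bsub>?P\<^esub> ?h x" if "r \<in> carrier R" "x \<in> carrier ?S" for r x
      by (rule direct_sum_eqI[of _ J "\<lambda>_. F"], intro h S.smult_closed that, intro P.smult_closed h that)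
         (simp add: direct_sum_apply F.smult_zero_right that)
  qed
  show "bij_betw ?h (carrier ?S) {p \<in> carrier ?P. \<forall>j\<in>J. j \<notin> B \<longrightarrow> p j = \<zero>\<^bsub>F\<^esub>}"
  proof (rule bij_betw_byWitness[where f' = ?g])
    show "\<forall>q\<in>carrier ?S. ?g (?h q) = q"
    proof
      fix q assume q: "q \<in> carrier ?S"
      show "?g (?h q) = q"
        by (rule direct_sum_eqI[of _ "e ` B" "\<lambda>_. F", OF g[OF h[OF q]] q]) (use B e in auto)
    qed
    show "\<forall>p\<in>{p \<in> carrier ?P. \<forall>j\<in>J. j \<notin> B \<longrightarrow> p j = \<zero>\<^bsub>F\<^esub>}. ?h (?g p) = p"
    proof
      fix p assume p: "p \<in> {p \<in> carrier ?P. \<forall>j\<in>J. j \<notin> B \<longrightarrow> p j = \<zero>\<^bsub>F\<^esub>}"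
      show "?h (?g p) = p"
        by (rule direct_sum_eqI[of _ J "\<lambda>_. F", OF h[OF g]]) (use p e in auto)
    qed
    show "?h ` carrier ?S \<subseteq> {p \<in> carrier ?P. \<forall>j\<in>J. j \<notin> B \<longrightarrow> p j = \<zero>\<^bsub>F\<^esub>}"
      using h by auto
    show "?g ` {p \<in> carrier ?P. \<forall>j\<in>J. j \<notin> B \<longrightarrow> p j = \<zero>\<^bsub>F\<^esub>} \<subseteq> carrier ?S"
      using g by auto
  qed
qed

section \<open>Finite sums of homomorphic images\<close>

lemma (in abelian_monoid) finsum_eq_single:
  assumes "finite K" "k \<in> K" "t k \<in> carrier G" and "\<And>l. \<lbrakk>l \<in> K; l \<noteq> k\<rbrakk> \<Longrightarrow> t l = \<zero>"
  shows "finsum G t K = t k"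
proof -
  have "finsum G t K = finsum G t (insert k (K - {k}))"
    using assms(2) by (simp add: insert_absorb)
  also have "\<dots> = t k \<oplus> finsum G t (K - {k})"
    using assms by (intro add.finprod_insert) auto
  also have "finsum G t (K - {k}) = \<zero>"
    using assms(4) by (intro add.finprod_one_eqI) auto
  finally show ?thesis using assms(3) by simp
qed

lemma finsum_additive:
  assumes "abelian_monoid G" "abelian_monoid H"
    and "h \<in> carrier G \<rightarrow> carrier H" and "h \<zero>\<^bsub>G\<^esub> = \<zero>\<^bsub>H\<^esub>"
    and "\<And>x y. \<lbrakk>x \<in> carrier G; y \<in> carrier G\<rbrakk> \<Longrightarrow> h (x \<oplus>\<^bsub>G\<^esub> y) = h x \<oplus>\<^bsub>H\<^esub> h y"
    and "finite K" and "t \<in> K \<rightarrow> carrier G"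
  shows "h (finsum G t K) = finsum H (\<lambda>k. h (t k)) K"
proof -
  interpret G: abelian_monoid G by fact
  interpret H: abelian_monoid H by fact
  show ?thesis
    using assms(6,7)
  proof (induction K rule: finite_induct)
    case empty
    then show ?case using assms(4) by simp
  next
    case (insert k K)
    then have "t k \<in> carrier G" "t \<in> K \<rightarrow> carrier G" by auto
    moreover from this have "(\<lambda>k. h (t k)) \<in> K \<rightarrow> carrier H" "h (t k) \<in> carrier H"
      using assms(3) by auto
    ultimately show ?case
      using insert assms(5) by simp
  qed
qed

text \<open>
  This is the sum of the images of the \<open>h k\<close>. Describing the sum of the images by explicit finite sums
  allows an element of a generated submodule to be inspected component by component.
\<close>

lemma (in right_module) submodule_finite_sums:
  assumes F: "right_module R F" and h: "\<And>k. k \<in> L \<Longrightarrow> h k \<in> right_module_hom R F M"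
  shows "submodule {finsum M (\<lambda>k. h k (x k)) K |K x. finite K \<and> K \<subseteq> L \<and> x \<in> K \<rightarrow> carrier F} R M"
    (is "submodule ?S R M")
proof -
  interpret F: right_module R F by fact
  note hc = right_module_homD(1)[OF h] and ha = right_module_homD(2)[OF h] and hs = right_module_homD(3)[OF h]
    and h0 = right_module_hom_zero[OF F right_module_axioms h]
  have I: "finsum M (\<lambda>k. h k (x k)) K \<in> ?S" if "finite K" "K \<subseteq> L" "x \<in> K \<rightarrow> carrier F" for K x
    using that by blast
  \<comment> \<open>Two finite sums are added by extending both families by zero to the union of the index sets.\<close>
  have extend: "finsum M (\<lambda>k. h k (x k)) K = finsum M (\<lambda>k. h k (if k \<in> K then x k else \<zero>\<^bsub>F\<^esub>)) K'"
    if "finite K'" "K \<subseteq> K'" "K' \<subseteq> L" "x \<in> K \<rightarrow> carrier F" for K K' x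
    using that by (intro M.add.finprod_mono_neutral_cong_left) (auto intro!: hc simp: h0 subset_iff)
  show ?thesis
  proof (rule submoduleI_right)
    show "?S \<subseteq> carrier M"
      by (auto intro!: M.finsum_closed hc)
    show "\<zero>\<^bsub>M\<^esub> \<in> ?S"
      using I[of "{}" "\<lambda>_. \<zero>\<^bsub>F\<^esub>"] by simp
    show "u \<oplus>\<^bsub>M\<^esub> v \<in> ?S" if "u \<in> ?S" "v \<in> ?S" for u v
    proof -
      from that(1) obtain K x where K: "finite K" "K \<subseteq> L" "x \<in> K \<rightarrow> carrier F" and u: "u = finsum M (\<lambda>k. h k (x k)) K"
        by blast
      from that(2) obtain K' x' where K': "finite K'" "K' \<subseteq> L" "x' \<in> K' \<rightarrow> carrier F" and v: "v = finsum M (\<lambda>k. h k (x' k)) K'"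
        by blast
      let ?x = "\<lambda>k. if k \<in> K then x k else \<zero>\<^bsub>F\<^esub>" and ?x' = "\<lambda>k. if k \<in> K' then x' k else \<zero>\<^bsub>F\<^esub>"
      have x: "?x k \<in> carrier F" and x': "?x' k \<in> carrier F" for k
        using K K' by auto
      have L: "k \<in> K \<union> K' \<Longrightarrow> k \<in> L" for k using K K' by auto
      have "u \<oplus>\<^bsub>M\<^esub> v = finsum M (\<lambda>k. h k (?x k)) (K \<union> K') \<oplus>\<^bsub>M\<^esub> finsum M (\<lambda>k. h k (?x' k)) (K \<union> K')"
        unfolding u v using K K' by (intro arg_cong2[where f = "add M"] extend) auto
      also have "\<dots> = finsum M (\<lambda>k. h k (?x k) \<oplus>\<^bsub>M\<^esub> h k (?x' k)) (K \<union> K')"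
        by (rule M.add.finprod_multf[symmetric]; intro funcsetI hc L x x')
      also have "\<dots> = finsum M (\<lambda>k. h k (?x k \<oplus>\<^bsub>F\<^esub> ?x' k)) (K \<union> K')"
        by (rule M.add.finprod_cong'; intro refl funcsetI hc ha[symmetric] L x x' F.M.a_closed)
      finally have eq: "u \<oplus>\<^bsub>M\<^esub> v = finsum M (\<lambda>k. h k (?x k \<oplus>\<^bsub>F\<^esub> ?x' k)) (K \<union> K')" .
      show ?thesis
        unfolding eq using K K' by (intro I funcsetI F.M.a_closed x x') auto
    qed
    show "r \<odot>\<^bsub>M\<^esub> u \<in> ?S" if r: "r \<in> carrier R" and "u \<in> ?S" for r u
    proof -
      from that(2) obtain K x where K: "finite K" "K \<subseteq> L" "x \<in> K \<rightarrow> carrier F" and u: "u = finsum M (\<lambda>k. h k (x k)) K"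
        by blast
      have "r \<odot>\<^bsub>M\<^esub> u = finsum M (\<lambda>k. r \<odot>\<^bsub>M\<^esub> h k (x k)) K"
        unfolding u
        by (rule finsum_additive[OF M.abelian_monoid_axioms M.abelian_monoid_axioms])
           (use r K in \<open>auto intro!: hc smult_closed simp: smult_zero_right smult_r_distr\<close>)
      also have "\<dots> = finsum M (\<lambda>k. h k (r \<odot>\<^bsub>F\<^esub> x k)) K"
        using r K by (intro M.add.finprod_cong') (auto intro!: hc hs[symmetric] F.smult_closed)
      finally have eq: "r \<odot>\<^bsub>M\<^esub> u = finsum M (\<lambda>k. h k (r \<odot>\<^bsub>F\<^esub> x k)) K" .
      show ?thesis
        unfolding eq using r K by (intro I) (auto intro!: F.smult_closed)
    qed
  qed
qed

section \<open>The modules P and G\<close>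

text \<open>
  What the module theory needs to know about ladders: the ladder points index summands \<open>Off\<close> of \<open>P\<close>, and
  two ladders share only finitely many points.
\<close>

locale ladder_quotient = F?: right_module R F
  for R :: "('r, 'a) ring_scheme" (structure) and F :: "('r, 'f, 'b) module_scheme" +
  fixes f :: "nat \<Rightarrow> 'f \<Rightarrow> 'f" and W :: "'o rel" and s :: "'o \<Rightarrow> nat \<Rightarrow> 'o"
  assumes f_hom: "\<And>i. f i \<in> right_module_hom R F F"
    and ladder_off: "\<And>\<alpha> i. \<alpha> \<in> cof_omega W \<Longrightarrow> s \<alpha> i \<in> Field W - cof_omega W"
    and ladder_inj: "\<And>\<alpha>. \<alpha> \<in> cof_omega W \<Longrightarrow> inj (s \<alpha>)"
    and ladders_almost_disjoint: "\<And>\<alpha> \<beta>. \<lbrakk>\<alpha> \<in> cof_omega W; \<beta> \<in> cof_omega W; \<alpha> \<noteq> \<beta>\<rbrakk> \<Longrightarrow>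
      finite (range (s \<alpha>) \<inter> range (s \<beta>))"
begin

abbreviation "E \<equiv> cof_omega W"
abbreviation "J \<equiv> summands W"
abbreviation "P \<equiv> P_module F W"
abbreviation "G \<equiv> G_sub R F f W s"
abbreviation "copy \<equiv> P_copy F W"
abbreviation "Q \<equiv> M_module R F f W s"
abbreviation "part \<equiv> M_part R F f W s"

definition supported :: "'o summand set \<Rightarrow> ('o summand \<Rightarrow> 'f) set"
  where "supported B = {p \<in> carrier P. \<forall>j\<in>J. j \<notin> B \<longrightarrow> p j = \<zero>\<^bsub>F\<^esub>}"

definition blocks :: "'o set \<Rightarrow> 'o summand set"
  where "blocks A = (\<Union>\<alpha>\<in>A. block W \<alpha>)"

text \<open>The homomorphism \<open>g\<^bsub>\<alpha>,i\<^esub>\<close> whose image is \<open>g_image F f W s \<alpha> i\<close>.\<close>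

definition g :: "'o \<Rightarrow> nat \<Rightarrow> 'f \<Rightarrow> ('o summand \<Rightarrow> 'f)"
  where "g \<alpha> i x = (copy (Off (s \<alpha> i)) x \<ominus>\<^bsub>P\<^esub> copy (On \<alpha> i) x) \<oplus>\<^bsub>P\<^esub> copy (On \<alpha> (Suc i)) (f i x)"

lemma F_right_module: "right_module R F"
  by (rule right_module_axioms)

lemma P_right_module: "right_module R P"
  unfolding P_module_def by (rule direct_sum_right_module[OF F.R.ring_axioms F_right_module])

sublocale P: right_module R P
  by (rule P_right_module)

lemma cof_omega_Field: "E \<subseteq> Field W"
  by (auto simp: cof_omega_def)

lemma summands_iff [simp]:
  "On \<alpha> i \<in> J \<longleftrightarrow> \<alpha> \<in> E"
  "Off \<beta> \<in> J \<longleftrightarrow> \<beta> \<in> Field W - E"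
  using cof_omega_Field by (auto simp: summands_def block_def split: if_splits)

lemma copy_hom: "j \<in> J \<Longrightarrow> copy j \<in> right_module_hom R F P"
  unfolding P_copy_def P_module_def by (rule direct_sum_summand_inj[OF F_right_module])

lemma copy_closed: "\<lbrakk>j \<in> J; x \<in> carrier F\<rbrakk> \<Longrightarrow> copy j x \<in> carrier P"
  by (rule right_module_homD(1)[OF copy_hom])

lemma copy_apply: "i \<in> J \<Longrightarrow> copy j x i = (if i = j then x else \<zero>\<^bsub>F\<^esub>)"
  by (simp add: P_copy_def summand_inj_apply)

lemma component_hom: "j \<in> J \<Longrightarrow> (\<lambda>p. p j) \<in> right_module_hom R P F"
  unfolding P_module_def by (rule direct_sum_component_hom)

lemma supported_submodule: "submodule (supported B) R P"
  unfolding supported_def P_module_def by (rule direct_sum_supported_submodule[OF F.R.ring_axioms F_right_module])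

text \<open>
  Whether \<open>F\<^sub>A\<close>, or its image in \<open>M\<close>, lies in a given submodule is thus decided on the generators \<open>copy j x\<close>.
\<close>

lemma supported_subset_submodule:
  assumes "submodule V R P" and "\<And>j x. \<lbrakk>j \<in> J; j \<in> B; x \<in> carrier F\<rbrakk> \<Longrightarrow> copy j x \<in> V"
  shows "supported B \<subseteq> V"
proof
  fix p assume p: "p \<in> supported B"
  then have p0: "p j = \<zero>\<^bsub>F\<^esub>" if "j \<in> J" "j \<notin> B" for j
    using that by (simp add: supported_def)
  show "p \<in> V"
  proof (rule direct_sum_in_submodule[where I = J and D = "\<lambda>_. F", OF F.R.ring_axioms F_right_module,
        folded P_module_def P_copy_def, OF assms(1)])
    show "copy j x \<in> V" if "j \<in> J" "p j \<noteq> \<zero>\<^bsub>F\<^esub>" "x \<in> carrier F" for j x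
      using that p0 by (intro assms(2)) auto
    show "p \<in> carrier P" using p by (simp add: supported_def)
  qed
qed

lemma copy_supported: "\<lbrakk>j \<in> J; j \<in> B; x \<in> carrier F\<rbrakk> \<Longrightarrow> copy j x \<in> supported B"
  by (auto simp: supported_def copy_closed copy_apply)

lemma F_part_eq: "F_part F W A = supported (blocks A)"
  by (simp add: F_part_def supported_def blocks_def)

lemma f_closed: "x \<in> carrier F \<Longrightarrow> f i x \<in> carrier F"
  by (rule right_module_homD(1)[OF f_hom])

lemma g_image_eq: "g_image F f W s \<alpha> i = g \<alpha> i ` carrier F"
  by (auto simp: g_image_def g_def)

lemma g_summands: "\<alpha> \<in> E \<Longrightarrow> Off (s \<alpha> i) \<in> J"
  using ladder_off by auto

lemma g_closed: "\<lbrakk>\<alpha> \<in> E; x \<in> carrier F\<rbrakk> \<Longrightarrow> g \<alpha> i x \<in> carrier P"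
  using ladder_off by (auto simp: g_def intro!: P.M.a_closed P.M.minus_closed copy_closed f_closed)

lemma g_apply:
  assumes "\<alpha> \<in> E" "x \<in> carrier F" "j \<in> J"
  shows "g \<alpha> i x j = (copy (Off (s \<alpha> i)) x j \<ominus>\<^bsub>F\<^esub> copy (On \<alpha> i) x j) \<oplus>\<^bsub>F\<^esub> copy (On \<alpha> (Suc i)) (f i x) j"
proof -
  have "copy (Off (s \<alpha> i)) x \<in> carrier P" "copy (On \<alpha> i) x \<in> carrier P" "copy (On \<alpha> (Suc i)) (f i x) \<in> carrier P"
    using assms ladder_off by (auto intro!: copy_closed f_closed)
  then show ?thesis
    unfolding g_def
    by (simp add: right_module_homD(2)[OF component_hom[OF assms(3)]]
        right_module_hom_minus[OF P_right_module F_right_module component_hom[OF assms(3)]])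
qed

lemma
  assumes "\<alpha> \<in> E" "x \<in> carrier F"
  shows g_apply_Off: "\<beta> \<in> Field W - E \<Longrightarrow> g \<alpha> i x (Off \<beta>) = (if s \<alpha> i = \<beta> then x else \<zero>\<^bsub>F\<^esub>)"
    and g_apply_On: "\<beta> \<in> E \<Longrightarrow> g \<alpha> i x (On \<beta> k) =
      (if \<alpha> = \<beta> \<and> i = k then \<ominus>\<^bsub>F\<^esub> x else if \<alpha> = \<beta> \<and> Suc i = k then f i x else \<zero>\<^bsub>F\<^esub>)"
  using assms f_closed[OF assms(2), of i] by (auto simp: g_apply copy_apply a_minus_def)

lemma g_hom:
  assumes \<alpha>: "\<alpha> \<in> E" shows "g \<alpha> i \<in> right_module_hom R F P"
proof -
  note off = copy_hom[OF g_summands[OF \<alpha>, of i]] and on = copy_hom[of "On \<alpha> _"]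
  have [simp]: "copy (Off (s \<alpha> i)) x \<in> carrier P" "copy (On \<alpha> k) x \<in> carrier P" if "x \<in> carrier F" for x k
    using right_module_homD(1)[OF off] right_module_homD(1)[OF on] that \<alpha> by auto
  show ?thesis
    unfolding right_module_hom_def
  proof (intro CollectI conjI ballI funcsetI g_closed \<alpha>)
    fix x y assume xy: "x \<in> carrier F" "y \<in> carrier F"
    show "g \<alpha> i (x \<oplus>\<^bsub>F\<^esub> y) = g \<alpha> i x \<oplus>\<^bsub>P\<^esub> g \<alpha> i y"
      using xy \<alpha> unfolding g_def
      by (simp add: right_module_homD(2)[OF off] right_module_homD(2)[OF on] right_module_homD(2)[OF f_hom]
          f_closed a_minus_def P.M.minus_add P.M.a_ac)
  next
    fix r x assume rx: "r \<in> carrier R" "x \<in> carrier F"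
    have "\<ominus>\<^bsub>P\<^esub> (r \<odot>\<^bsub>P\<^esub> y) = r \<odot>\<^bsub>P\<^esub> (\<ominus>\<^bsub>P\<^esub> y)" if "y \<in> carrier P" for y
      using that rx
      by (intro P.M.minus_equality) (simp_all add: P.smult_r_distr[symmetric] P.smult_closed P.smult_zero_right P.M.l_neg)
    then show "g \<alpha> i (r \<odot>\<^bsub>F\<^esub> x) = r \<odot>\<^bsub>P\<^esub> g \<alpha> i x"
      using rx \<alpha> unfolding g_def
      by (simp add: right_module_homD(3)[OF off] right_module_homD(3)[OF on] right_module_homD(3)[OF f_hom]
          f_closed a_minus_def P.smult_r_distr P.smult_closed)
  qed
qed

lemma g_image_subset: "\<alpha> \<in> E \<Longrightarrow> (\<Union>i. g_image F f W s \<alpha> i) \<subseteq> carrier P"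
  by (auto simp: g_image_eq g_closed)

lemma G_part_submodule: "\<alpha> \<in> E \<Longrightarrow> submodule (G_part R F f W s \<alpha>) R P"
  unfolding G_part_def by (rule P.submodule_span_submodule[OF g_image_subset])

lemma G_submodule: "submodule G R P"
  unfolding G_sub_def
  using P.submodule_subset[OF G_part_submodule] by (intro P.submodule_span_submodule) auto

lemma g_in_G:
  assumes "\<alpha> \<in> E" "x \<in> carrier F" shows "g \<alpha> i x \<in> G"
proof -
  have "g \<alpha> i x \<in> G_part R F f W s \<alpha>"
    unfolding G_part_def submodule_span_def
    by (rule subsetD[OF hull_subset]) (use assms in \<open>auto simp: g_image_eq\<close>)
  then show ?thesis
    unfolding G_sub_def submodule_span_def[of _ _ "\<Union>\<alpha>\<in>E. _ \<alpha>"]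
    by (intro subsetD[OF hull_subset]) (use assms in auto)
qed

text \<open>
  Zero coefficients are dropped, so that every index in \<open>K\<close> contributes a nonzero relation; the
  leading-term argument relies on this.
\<close>

lemma G_finite_sum:
  assumes "p \<in> G"
  obtains K x where "finite K" and "\<And>\<alpha> i. (\<alpha>, i) \<in> K \<Longrightarrow> \<alpha> \<in> E \<and> x \<alpha> i \<in> carrier F \<and> x \<alpha> i \<noteq> \<zero>\<^bsub>F\<^esub>"
    and "p = finsum P (\<lambda>(\<alpha>, i). g \<alpha> i (x \<alpha> i)) K"
proof -
  define h where "h k = (case k of (\<alpha>, i) \<Rightarrow> g \<alpha> i)" for k
  have h: "h k \<in> right_module_hom R F P" if "k \<in> E \<times> UNIV" for k
    using that by (auto simp: h_def g_hom)
  define S where "S = {finsum P (\<lambda>k. h k (x k)) K |K x. finite K \<and> K \<subseteq> E \<times> UNIV \<and> x \<in> K \<rightarrow> carrier F}"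
  have S: "submodule S R P"
    unfolding S_def by (rule P.submodule_finite_sums[OF F_right_module h])
  have "g \<alpha> i x \<in> S" if "\<alpha> \<in> E" "x \<in> carrier F" for \<alpha> i x
  proof -
    have "finsum P (\<lambda>k. h k ((\<lambda>_. x) k)) {(\<alpha>, i)} = g \<alpha> i x"
      using that by (simp add: h_def g_closed)
    then show ?thesis
      unfolding S_def using that by (intro CollectI exI[of _ "{(\<alpha>, i)}"] exI[of _ "\<lambda>_. x"]) auto
  qed
  then have "G_part R F f W s \<alpha> \<subseteq> S" if "\<alpha> \<in> E" for \<alpha>
    unfolding G_part_def submodule_span_def using S that by (intro hull_minimal) (auto simp: g_image_eq)
  then have "G \<subseteq> S"
    unfolding G_sub_def submodule_span_def[of _ _ "\<Union>\<alpha>\<in>E. _ \<alpha>"] using S by (intro hull_minimal) auto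
  with assms have "p \<in> S" by (rule subsetD[rotated])
  then obtain K x where K: "finite K" "K \<subseteq> E \<times> UNIV" "x \<in> K \<rightarrow> carrier F"
    and p: "p = finsum P (\<lambda>k. h k (x k)) K"
    unfolding S_def by (elim CollectE exE conjE)
  define K' where "K' = {k \<in> K. x k \<noteq> \<zero>\<^bsub>F\<^esub>}"
  have "p = finsum P (\<lambda>k. h k (x k)) K'"
    unfolding p K'_def
    by (rule P.M.add.finprod_mono_neutral_cong_right)
       (use K in \<open>auto intro!: right_module_homD(1)[OF h] simp: right_module_hom_zero[OF F_right_module P_right_module h]\<close>)
  also have "\<dots> = finsum P (\<lambda>(\<alpha>, i). g \<alpha> i (x (\<alpha>, i))) K'"
    by (simp add: h_def case_prod_unfold)
  finally show ?thesis
    using K by (intro that[of K' "\<lambda>\<alpha> i. x (\<alpha>, i)"]) (auto simp: K'_def)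
qed

text \<open>How leading terms are read off: a component to which only one summand contributes.\<close>

lemma finsum_g_apply:
  assumes K: "finite K" and x: "\<And>\<alpha> i. (\<alpha>, i) \<in> K \<Longrightarrow> \<alpha> \<in> E \<and> x \<alpha> i \<in> carrier F"
    and k: "(\<beta>, k) \<in> K" and j: "j \<in> J"
    and single: "\<And>\<alpha> i. \<lbrakk>(\<alpha>, i) \<in> K; (\<alpha>, i) \<noteq> (\<beta>, k)\<rbrakk> \<Longrightarrow> g \<alpha> i (x \<alpha> i) j = \<zero>\<^bsub>F\<^esub>"
  shows "finsum P (\<lambda>(\<alpha>, i). g \<alpha> i (x \<alpha> i)) K j = g \<beta> k (x \<beta> k) j"
proof -
  note hom = component_hom[OF j]
  let ?t = "\<lambda>(\<alpha>, i). g \<alpha> i (x \<alpha> i)"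
  have t: "?t \<in> K \<rightarrow> carrier P"
    using x by (auto intro: g_closed)
  have "finsum P ?t K j = finsum F (\<lambda>k. ?t k j) K"
    using right_module_homD[OF hom] right_module_hom_zero[OF P_right_module F_right_module hom] K t
    by (intro finsum_additive[where h = "\<lambda>p. p j", OF P.M.abelian_monoid_axioms F.M.abelian_monoid_axioms]) auto
  also have "\<dots> = ?t (\<beta>, k) j"
    using single k right_module_homD(1)[OF hom g_closed] x[OF k]
    by (intro F.M.finsum_eq_single[OF K k, where t = "\<lambda>k. ?t k j"]) auto
  finally show ?thesis by simp
qed

section \<open>The structure of the countable parts\<close>

text \<open>
  The function \<open>rk\<close> enumerates \<open>A\<close>. At the indices in \<open>overlap A rk \<alpha>\<close> the ladder of \<open>\<alpha>\<close> runs into the ladder of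
  an earlier member of \<open>A\<close>; there the copy \<open>F\<^bsub>\<alpha>,i\<^esub>\<close> is redundant in \<open>M\<^bsub>A\<^esub>\<close>.
\<close>

definition overlap :: "'o set \<Rightarrow> ('o \<Rightarrow> nat) \<Rightarrow> 'o \<Rightarrow> nat set"
  where "overlap A rk \<alpha> = {i. \<exists>\<beta>\<in>A \<inter> E. rk \<beta> < rk \<alpha> \<and> s \<alpha> i \<in> range (s \<beta>)}"

text \<open>
  The positions of those summands of \<open>P\<close> that map isomorphically onto the summands of a direct decomposition
  of \<open>M\<^bsub>A\<^esub>\<close>.
\<close>

definition basis :: "'o set \<Rightarrow> ('o \<Rightarrow> nat) \<Rightarrow> 'o summand set"
  where "basis A rk = {On \<alpha> i |\<alpha> i. \<alpha> \<in> A \<inter> E \<and> i \<notin> overlap A rk \<alpha>} \<union> Off ` (A \<inter> ladder_free W s)"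

lemma ladder_free_subset: "ladder_free W s \<subseteq> Field W - E"
  by (auto simp: ladder_free_def)

lemma basis_subset_summands: "basis A rk \<subseteq> J"
  using ladder_free_subset by (auto simp: basis_def)

lemma basis_subset_blocks: "basis A rk \<subseteq> blocks A"
  using ladder_free_subset by (auto simp: basis_def blocks_def block_def)

text \<open>
  Only finitely many members of \<open>A\<close> precede \<open>\<alpha>\<close>, and each of their ladders meets that of \<open>\<alpha>\<close> in a finite
  set.
\<close>

lemma finite_overlap:
  assumes rk: "inj_on rk A" and \<alpha>: "\<alpha> \<in> E"
  shows "finite (overlap A rk \<alpha>)"
proof -
  have "finite (rk -` {..<rk \<alpha>} \<inter> A)"
    by (rule finite_vimage_IntI[OF _ rk]) simp
  then have "finite {\<beta> \<in> A \<inter> E. rk \<beta> < rk \<alpha>}"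
    by (rule finite_subset[rotated]) auto
  moreover have "finite {i. s \<alpha> i \<in> range (s \<beta>)}" if "\<beta> \<in> E" "rk \<beta> < rk \<alpha>" for \<beta>
    using finite_vimageI[OF ladders_almost_disjoint[OF \<alpha> that(1)] ladder_inj[OF \<alpha>]] that(2)
    by (auto simp: vimage_def)
  ultimately have "finite (\<Union>\<beta>\<in>{\<beta> \<in> A \<inter> E. rk \<beta> < rk \<alpha>}. {i. s \<alpha> i \<in> range (s \<beta>)})"
    by (intro finite_UN_I) auto
  then show ?thesis
    by (rule finite_subset[rotated]) (auto simp: overlap_def)
qed

text \<open>
  The copies of \<open>F\<close> at basis positions are independent modulo \<open>G\<close>. Among the relations that occur in
  \<open>p\<close>, the one with the last \<open>\<alpha>\<close> and the least \<open>i\<close> for it would leave a nonzero component of \<open>p\<close> at the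
  ladder point \<open>s \<alpha> i\<close>.
\<close>

lemma G_inter_basis:
  assumes rk: "inj_on rk A" and pG: "p \<in> G" and p: "p \<in> supported (basis A rk)"
  shows "p = \<zero>\<^bsub>P\<^esub>"
proof -
  obtain K x where K: "finite K"
    and Kx: "\<And>\<alpha> i. (\<alpha>, i) \<in> K \<Longrightarrow> \<alpha> \<in> E \<and> x \<alpha> i \<in> carrier F \<and> x \<alpha> i \<noteq> \<zero>\<^bsub>F\<^esub>"
    and p_sum: "p = finsum P (\<lambda>(\<alpha>, i). g \<alpha> i (x \<alpha> i)) K"
    by (rule G_finite_sum[OF pG], rule that)
  have p0: "p j = \<zero>\<^bsub>F\<^esub>" if "j \<in> J" "j \<notin> basis A rk" for j
    using p that by (auto simp: supported_def)
  define first where "first \<alpha> = (LEAST i. (\<alpha>, i) \<in> K)" for \<alpha>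
  have first: "(\<alpha>, first \<alpha>) \<in> K" "\<And>j. (\<alpha>, j) \<in> K \<Longrightarrow> first \<alpha> \<le> j" if "(\<alpha>, i) \<in> K" for \<alpha> i
    using LeastI[of "\<lambda>i. (\<alpha>, i) \<in> K", OF that] Least_le[of "\<lambda>i. (\<alpha>, i) \<in> K"] by (auto simp: first_def)
  \<comment> \<open>The only other relation that involves the position \<open>(\<alpha>, i)\<close> is the one with index \<open>(\<alpha>, i - 1)\<close>, which
    does not occur when \<open>i\<close> is least.\<close>
  have in_basis: "\<alpha> \<in> A \<and> first \<alpha> \<notin> overlap A rk \<alpha>" if "(\<alpha>, i) \<in> K" for \<alpha> i
  proof (rule ccontr)
    assume "\<not> (\<alpha> \<in> A \<and> first \<alpha> \<notin> overlap A rk \<alpha>)"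
    then have "On \<alpha> (first \<alpha>) \<notin> basis A rk" by (auto simp: basis_def)
    moreover have E: "\<alpha> \<in> E" using Kx[OF that] by simp
    ultimately have "p (On \<alpha> (first \<alpha>)) = \<zero>\<^bsub>F\<^esub>" by (intro p0) auto
    moreover have "p (On \<alpha> (first \<alpha>)) = g \<alpha> (first \<alpha>) (x \<alpha> (first \<alpha>)) (On \<alpha> (first \<alpha>))"
      unfolding p_sum
    proof (rule finsum_g_apply[OF K _ first(1)[OF that]])
      show "g \<beta> j (x \<beta> j) (On \<alpha> (first \<alpha>)) = \<zero>\<^bsub>F\<^esub>" if "(\<beta>, j) \<in> K" "(\<beta>, j) \<noteq> (\<alpha>, first \<alpha>)" for \<beta> j
      proof -
        have "\<not> (\<beta> = \<alpha> \<and> Suc j = first \<alpha>)" using first(2)[OF that(1)] that(1) by fastforce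
        then show ?thesis
          using that(2) Kx[OF that(1)] E by (auto simp: g_apply_On)
      qed
    qed (use Kx E in auto)
    ultimately show False
      using Kx[OF first(1)[OF that]] E by (simp add: g_apply_On)
  qed
  have "K = {}"
  proof (rule ccontr)
    assume "K \<noteq> {}"
    \<comment> \<open>By \<open>in_basis\<close> all ordinals that occur lie in \<open>A\<close>, where \<open>rk\<close> is injective; so the one of largest rank
      has all the others before it in the enumeration.\<close>
    define m where "m = Max ((rk \<circ> fst) ` K)"
    have "m \<in> (rk \<circ> fst) ` K" unfolding m_def using K \<open>K \<noteq> {}\<close> by (intro Max_in) auto
    then obtain \<alpha> i where \<alpha>i: "(\<alpha>, i) \<in> K" and m: "rk \<alpha> = m" by auto
    have max: "rk \<beta> \<le> rk \<alpha>" if "(\<beta>, j) \<in> K" for \<beta> j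
      unfolding m m_def using K that by (intro Max_ge) force+
    let ?j = "Off (s \<alpha> (first \<alpha>))"
    have E: "\<alpha> \<in> E" and A: "\<alpha> \<in> A" and ov: "first \<alpha> \<notin> overlap A rk \<alpha>"
      using Kx[OF \<alpha>i] in_basis[OF \<alpha>i] by auto
    have "?j \<notin> basis A rk" using E by (auto simp: basis_def ladder_free_def)
    then have "p ?j = \<zero>\<^bsub>F\<^esub>" using ladder_off[OF E] by (intro p0) auto
    moreover have "p ?j = g \<alpha> (first \<alpha>) (x \<alpha> (first \<alpha>)) ?j"
      unfolding p_sum
    proof (rule finsum_g_apply[OF K _ first(1)[OF \<alpha>i]])
      fix \<beta> j assume \<beta>j: "(\<beta>, j) \<in> K" "(\<beta>, j) \<noteq> (\<alpha>, first \<alpha>)"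
      have \<beta>: "\<beta> \<in> E" "\<beta> \<in> A" using Kx[OF \<beta>j(1)] in_basis[OF \<beta>j(1)] by auto
      have "s \<beta> j \<noteq> s \<alpha> (first \<alpha>)"
      proof
        assume eq: "s \<beta> j = s \<alpha> (first \<alpha>)"
        show False
        proof (cases "\<beta> = \<alpha>")
          case True
          then show False using eq \<beta>j(2) ladder_inj[OF E] by (auto dest: injD)
        next
          case False
          then have "rk \<beta> < rk \<alpha>"
            using max[OF \<beta>j(1)] inj_onD[OF rk _ \<beta>(2) A] by force
          then show False
            using ov \<beta> eq[symmetric] by (auto simp: overlap_def)
        qed
      qed
      then show "g \<beta> j (x \<beta> j) ?j = \<zero>\<^bsub>F\<^esub>"
        using Kx[OF \<beta>j(1)] ladder_off[OF E] by (simp add: g_apply_Off)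
    qed (use Kx ladder_off[OF E] in auto)
    ultimately show False
      using Kx[OF first(1)[OF \<alpha>i]] ladder_off[OF E] by (simp add: g_apply_Off)
  qed
  then show ?thesis by (simp add: p_sum)
qed

text \<open>The relation \<open>g \<alpha> i x\<close>, solved for its first and for its second term.\<close>

lemma copy_Off_in_submodule:
  assumes V: "submodule V R P" "G \<subseteq> V" and \<alpha>: "\<alpha> \<in> E" and x: "x \<in> carrier F"
    and on: "copy (On \<alpha> i) x \<in> V" and on_Suc: "copy (On \<alpha> (Suc i)) (f i x) \<in> V"
  shows "copy (Off (s \<alpha> i)) x \<in> V"
proof -
  let ?a = "copy (Off (s \<alpha> i)) x" and ?b = "copy (On \<alpha> i) x" and ?c = "copy (On \<alpha> (Suc i)) (f i x)"
  have [simp]: "?a \<in> carrier P" "?b \<in> carrier P" "?c \<in> carrier P"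
    using \<alpha> x ladder_off[OF \<alpha>] by (auto intro!: copy_closed f_closed)
  have "(g \<alpha> i x \<oplus>\<^bsub>P\<^esub> ?b) \<ominus>\<^bsub>P\<^esub> ?c \<in> V"
    using V g_in_G[OF \<alpha> x] on on_Suc by (intro P.submodule_minus[OF V(1)] P.submodule_add[OF V(1)]) auto
  moreover have "(g \<alpha> i x \<oplus>\<^bsub>P\<^esub> ?b) \<ominus>\<^bsub>P\<^esub> ?c = ?a"
    by (simp add: g_def a_minus_def P.M.a_assoc P.M.a_comm[of ?b] P.M.r_neg P.M.l_neg P.M.r_neg1 P.M.r_neg2)
  ultimately show ?thesis by simp
qed

lemma copy_On_in_submodule:
  assumes V: "submodule V R P" "G \<subseteq> V" and \<alpha>: "\<alpha> \<in> E" and x: "x \<in> carrier F"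
    and off: "copy (Off (s \<alpha> i)) x \<in> V" and on_Suc: "copy (On \<alpha> (Suc i)) (f i x) \<in> V"
  shows "copy (On \<alpha> i) x \<in> V"
proof -
  let ?a = "copy (Off (s \<alpha> i)) x" and ?b = "copy (On \<alpha> i) x" and ?c = "copy (On \<alpha> (Suc i)) (f i x)"
  have [simp]: "?a \<in> carrier P" "?b \<in> carrier P" "?c \<in> carrier P"
    using \<alpha> x ladder_off[OF \<alpha>] by (auto intro!: copy_closed f_closed)
  have "(?a \<oplus>\<^bsub>P\<^esub> ?c) \<ominus>\<^bsub>P\<^esub> g \<alpha> i x \<in> V"
    using V g_in_G[OF \<alpha> x] off on_Suc by (intro P.submodule_minus[OF V(1)] P.submodule_add[OF V(1)]) auto
  moreover have "(?a \<oplus>\<^bsub>P\<^esub> ?c) \<ominus>\<^bsub>P\<^esub> g \<alpha> i x = ?b"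
  proof -
    have "g \<alpha> i x \<oplus>\<^bsub>P\<^esub> ?b = ?a \<oplus>\<^bsub>P\<^esub> ?c"
      by (simp add: g_def a_minus_def P.M.a_assoc P.M.a_comm[of ?c] P.M.r_neg P.M.l_neg P.M.r_neg1 P.M.r_neg2)
    then have "(?a \<oplus>\<^bsub>P\<^esub> ?c) \<ominus>\<^bsub>P\<^esub> g \<alpha> i x = (g \<alpha> i x \<oplus>\<^bsub>P\<^esub> ?b) \<ominus>\<^bsub>P\<^esub> g \<alpha> i x" by simp
    also have "\<dots> = ?b"
      using g_closed[OF \<alpha> x, of i] by (simp add: a_minus_def P.M.a_assoc P.M.a_comm[of ?b] P.M.r_neg2)
    finally show ?thesis .
  qed
  ultimately show ?thesis by simp
qed

text \<open>
  Induction along the enumeration of \<open>A\<close>, and for fixed \<open>\<alpha>\<close> downwards on \<open>i\<close> from a bound of the overlap. If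
  \<open>i\<close> is in the overlap, the copy at the ladder point \<open>s \<alpha> i = s \<beta> j\<close> is available from the earlier
  \<open>\<beta>\<close>, and the relation at \<open>(\<alpha>, i)\<close> yields \<open>F\<^bsub>\<alpha>,i\<^esub>\<close> from it and \<open>F\<^bsub>\<alpha>,i+1\<^esub>\<close>.
\<close>

lemma basis_generates:
  assumes rk: "inj_on rk A" and A: "A \<subseteq> E \<union> ladder_free W s"
  shows "supported (blocks A) \<subseteq> supported (basis A rk) <+>\<^bsub>P\<^esub> G"
proof -
  define V where "V = supported (basis A rk) <+>\<^bsub>P\<^esub> G"
  have V: "submodule V R P" "G \<subseteq> V" and basis_V: "supported (basis A rk) \<subseteq> V"
    unfolding V_def using P.submodule_set_add[OF supported_submodule G_submodule]
      P.submodule_set_addD[OF supported_submodule G_submodule] by auto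
  have On_V: "\<forall>i. \<forall>x\<in>carrier F. copy (On \<alpha> i) x \<in> V" if "\<alpha> \<in> A \<inter> E" for \<alpha>
    using that
  proof (induction "rk \<alpha>" arbitrary: \<alpha> rule: less_induct)
    case less
    note earlier = less.hyps
    obtain n where n: "\<And>i. i \<in> overlap A rk \<alpha> \<Longrightarrow> i < n"
      using finite_overlap[OF rk, of \<alpha>] less.prems finite_nat_iff_bounded by auto
    \<comment> \<open>Beyond the bound \<open>n\<close> the measure \<open>n - i\<close> stays \<open>0\<close>, but no index there belongs to the overlap.\<close>
    have "copy (On \<alpha> i) x \<in> V" if "x \<in> carrier F" for i x
      using that
    proof (induction "n - i" arbitrary: i x rule: less_induct)
      case (less i x)
      show ?case
      proof (cases "i \<in> overlap A rk \<alpha>")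
        case False
        then show ?thesis
          using \<open>\<alpha> \<in> A \<inter> E\<close> less.prems basis_V by (auto intro!: subsetD[OF basis_V] copy_supported simp: basis_def)
      next
        case True
        then obtain \<beta> j where \<beta>: "\<beta> \<in> A \<inter> E" "rk \<beta> < rk \<alpha>" and eq: "s \<alpha> i = s \<beta> j"
          by (auto simp: overlap_def)
        have "copy (Off (s \<beta> j)) x \<in> V"
          using earlier[OF \<beta>(2,1)] \<beta> less.prems by (intro copy_Off_in_submodule[OF V]) (auto simp: f_closed)
        moreover have "copy (On \<alpha> (Suc i)) (f i x) \<in> V"
          using n[OF True] less.prems by (intro less.hyps f_closed) auto
        ultimately show ?thesis
          using \<open>\<alpha> \<in> A \<inter> E\<close> less.prems eq by (auto intro: copy_On_in_submodule[OF V, of \<alpha> x i])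
      qed
    qed
    then show ?case by blast
  qed
  have "supported (blocks A) \<subseteq> V"
  proof (rule supported_subset_submodule[OF V(1)])
    fix j x assume j: "j \<in> blocks A" and x: "x \<in> carrier F"
    from j obtain \<alpha> where \<alpha>: "\<alpha> \<in> A" "j \<in> block W \<alpha>" by (auto simp: blocks_def)
    show "copy j x \<in> V"
    proof (cases "\<alpha> \<in> E")
      case True
      then show ?thesis using On_V[of \<alpha>] \<alpha> x by (auto simp: block_def)
    next
      case False
      then have "\<alpha> \<in> A \<inter> ladder_free W s" "j = Off \<alpha>" using \<alpha> A by (auto simp: block_def)
      then have "j \<in> basis A rk" by (simp add: basis_def)
      then show ?thesis
        using x basis_subset_summands basis_V by (blast intro: copy_supported)
    qed
  qed
  then show ?thesis by (simp add: V_def)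
qed

section \<open>The system of countable parts\<close>

abbreviation proj where "proj p \<equiv> G +>\<^bsub>P\<^esub> p"

lemma Q_right_module: "right_module R Q" and proj_hom: "proj \<in> right_module_hom R P Q"
  unfolding M_module_def by (rule P.quotient_module_right_module[OF G_submodule])+

lemma part_eq: "part A = proj ` supported (blocks A)"
  unfolding M_part_def F_part_eq by (rule P.coset_image_set_add[OF G_submodule supported_submodule])

lemma part_submodule: "submodule (part A) R Q"
  unfolding part_eq by (rule submodule_image[OF P_right_module Q_right_module proj_hom supported_submodule])

lemma supported_mono: "B \<subseteq> B' \<Longrightarrow> supported B \<subseteq> supported B'"
  by (auto simp: supported_def)

lemma blocks_mono: "A \<subseteq> A' \<Longrightarrow> blocks A \<subseteq> blocks A'"
  by (auto simp: blocks_def)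

lemma part_mono: "A \<subseteq> A' \<Longrightarrow> part A \<subseteq> part A'"
  unfolding part_eq by (intro image_mono supported_mono blocks_mono)

lemma part_eq_basis:
  assumes "inj_on rk A" and "A \<subseteq> E \<union> ladder_free W s"
  shows "part A = proj ` supported (basis A rk)"
proof
  have "part A \<subseteq> proj ` (supported (basis A rk) <+>\<^bsub>P\<^esub> G)"
    unfolding part_eq by (intro image_mono basis_generates assms)
  then show "part A \<subseteq> proj ` supported (basis A rk)"
    by (simp only: P.coset_image_set_add[OF G_submodule supported_submodule])
  show "proj ` supported (basis A rk) \<subseteq> part A"
    unfolding part_eq by (intro image_mono supported_mono basis_subset_blocks)
qed

lemma proj_inj_on_basis:
  assumes "inj_on rk A"
  shows "inj_on proj (supported (basis A rk))"
proof (rule inj_onI)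
  fix p q assume pq: "p \<in> supported (basis A rk)" "q \<in> supported (basis A rk)" "proj p = proj q"
  have [simp]: "p \<in> carrier P" "q \<in> carrier P"
    using pq by (auto simp: supported_def)
  have "p \<ominus>\<^bsub>P\<^esub> q \<in> G"
    using pq(3) by (simp add: P.quotient_module_coset_eq_iff[OF G_submodule])
  then have "p \<ominus>\<^bsub>P\<^esub> q = \<zero>\<^bsub>P\<^esub>"
    using pq by (intro G_inter_basis[OF assms] P.submodule_minus[OF supported_submodule])
  then show "p = q"
    using P.M.minus_equality[of p "\<ominus>\<^bsub>P\<^esub> q"] by (simp add: a_minus_def)
qed

lemma part_countable_sum:
  assumes "countable A" and A: "A \<subseteq> E \<union> ladder_free W s"
  shows "is_countable_sum_of R F (Q\<lparr>carrier := part A\<rparr>)"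
proof -
  define rk where "rk = to_nat_on A"
  have rk: "inj_on rk A" unfolding rk_def using assms(1) by (rule inj_on_to_nat_on)
  let ?B = "basis A rk"
  have "?B \<subseteq> case_prod On ` (A \<times> UNIV) \<union> Off ` A"
    by (auto simp: basis_def)
  then have B: "countable ?B"
    by (rule countable_subset) (use assms(1) in auto)
  define e where "e = to_nat_on ?B"
  have e: "inj_on e ?B" unfolding e_def using B by (rule inj_on_to_nat_on)
  let ?S = "direct_sum (e ` ?B) (\<lambda>_. F)"
  let ?U = "Q\<lparr>carrier := part A\<rparr>"
  obtain h where h: "h \<in> right_module_hom R ?S P" and bij: "bij_betw h (carrier ?S) (supported ?B)"
    using direct_sum_reindex[OF F_right_module basis_subset_summands e] unfolding P_module_def supported_def by blast
  interpret Q: right_module R Q by (rule Q_right_module)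
  have "bij_betw proj (supported ?B) (part A)"
    using proj_inj_on_basis[OF rk] part_eq_basis[OF rk A] by (simp add: bij_betw_def)
  then have bij': "bij_betw (proj \<circ> h) (carrier ?S) (carrier ?U)"
    using bij_betw_trans[OF bij] by simp
  have "proj \<circ> h \<in> right_module_hom R ?S ?U"
    using right_module_homD[OF h] right_module_homD[OF proj_hom] bij_betw_apply[OF bij']
    by (auto simp: right_module_hom_def)
  then have "right_module_isomorphic R ?S ?U"
    using bij' by (auto simp: right_module_isomorphic_def)
  then have "right_module_isomorphic R ?U ?S"
    by (rule right_module_isomorphic_sym[OF direct_sum_right_module[OF F.R.ring_axioms F_right_module]])
  then show ?thesis
    unfolding is_countable_sum_of_def using Q.submodule_right_module[OF part_submodule] by blast
qed

text \<open>
  For the nontrivial inclusion, the preimage of the union of the chain is a submodule of \<open>P\<close>, and it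
  contains every generator, since a generator belongs to the block of a single ordinal.
\<close>

lemma chain_Union_part:
  assumes ne: "\<C> \<noteq> {}" and chain: "\<And>U V. \<lbrakk>U \<in> \<C>; V \<in> \<C>\<rbrakk> \<Longrightarrow> U \<subseteq> V \<or> V \<subseteq> U"
    and a: "\<And>U. U \<in> \<C> \<Longrightarrow> part (a U) = U"
  shows "\<Union>\<C> = part (\<Union>U\<in>\<C>. a U)"
proof
  show "\<Union>\<C> \<subseteq> part (\<Union>U\<in>\<C>. a U)"
  proof (rule Union_least)
    fix U assume U: "U \<in> \<C>"
    then have "part (a U) \<subseteq> part (\<Union>U\<in>\<C>. a U)" by (intro part_mono) blast
    then show "U \<subseteq> part (\<Union>U\<in>\<C>. a U)" by (simp add: a[OF U])
  qed
  interpret Q: right_module R Q by (rule Q_right_module)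
  have sub: "submodule U R Q" if "U \<in> \<C>" for U
    using part_submodule[of "a U"] a[OF that] by simp
  define V where "V = {p \<in> carrier P. proj p \<in> \<Union>\<C>}"
  have "submodule V R P"
  proof (rule P.submoduleI_right)
    obtain U where "U \<in> \<C>" using ne by blast
    then show "\<zero>\<^bsub>P\<^esub> \<in> V"
      using Q.submodule_zero[OF sub] right_module_hom_zero[OF P_right_module Q_right_module proj_hom] by (auto simp: V_def)
    show "p \<oplus>\<^bsub>P\<^esub> q \<in> V" if pq: "p \<in> V" "q \<in> V" for p q
    proof -
      from pq obtain U U' where U: "U \<in> \<C>" "U' \<in> \<C>" "proj p \<in> U" "proj q \<in> U'" by (auto simp: V_def)
      then obtain U'' where "U'' \<in> \<C>" "proj p \<in> U''" "proj q \<in> U''" using chain[OF U(1,2)] by blast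
      then show ?thesis
        using pq Q.submodule_add[OF sub] right_module_homD(2)[OF proj_hom] by (auto simp: V_def)
    qed
    show "r \<odot>\<^bsub>P\<^esub> p \<in> V" if "r \<in> carrier R" "p \<in> V" for r p
      using that Q.submodule_smult[OF sub] right_module_homD(3)[OF proj_hom] P.smult_closed
      by (auto simp: V_def)
  qed (auto simp: V_def)
  moreover have "copy j x \<in> V" if j: "j \<in> J" "j \<in> blocks (\<Union>U\<in>\<C>. a U)" and x: "x \<in> carrier F" for j x
  proof -
    from j obtain U where U: "U \<in> \<C>" "j \<in> blocks (a U)" by (auto simp: blocks_def)
    then have "proj (copy j x) \<in> part (a U)"
      unfolding part_eq using copy_supported[OF j(1) _ x] by blast
    then show ?thesis
      using U a copy_closed[OF j(1) x] by (auto simp: V_def)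
  qed
  ultimately have "supported (blocks (\<Union>U\<in>\<C>. a U)) \<subseteq> V"
    by (rule supported_subset_submodule)
  then show "part (\<Union>U\<in>\<C>. a U) \<subseteq> \<Union>\<C>"
    unfolding part_eq by (auto simp: V_def)
qed

text \<open>
  The only case with content is a ladder point \<open>s \<alpha> i\<close>: the relation at \<open>(\<alpha>, i)\<close> places its copy of \<open>F\<close> into
  \<open>M\<^bsub>{\<alpha>}\<^esub>\<close>.
\<close>

lemma copy_in_block:
  assumes "j \<in> J"
  obtains \<alpha> where "\<alpha> \<in> E \<union> ladder_free W s"
    and "\<And>x. x \<in> carrier F \<Longrightarrow> copy j x \<in> supported (blocks {\<alpha>}) <+>\<^bsub>P\<^esub> G"
proof -
  have V: "submodule (supported (blocks {\<alpha>}) <+>\<^bsub>P\<^esub> G) R P" "G \<subseteq> supported (blocks {\<alpha>}) <+>\<^bsub>P\<^esub> G"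
    and sub: "supported (blocks {\<alpha>}) \<subseteq> supported (blocks {\<alpha>}) <+>\<^bsub>P\<^esub> G" for \<alpha>
    using P.submodule_set_add[OF supported_submodule G_submodule]
      P.submodule_set_addD[OF supported_submodule G_submodule] by auto
  have own: "copy k x \<in> supported (blocks {\<alpha>}) <+>\<^bsub>P\<^esub> G" if "k \<in> J" "k \<in> block W \<alpha>" "x \<in> carrier F" for k \<alpha> x
    using that by (intro subsetD[OF sub] copy_supported) (auto simp: blocks_def)
  show thesis
  proof (cases j)
    case (On \<alpha> i)
    then show thesis using assms by (intro that[of \<alpha>] own) (auto simp: block_def)
  next
    case (Off \<beta>)
    then have \<beta>: "\<beta> \<in> Field W - E" using assms by simp
    show thesis
    proof (cases "\<beta> \<in> ladder_free W s")
      case True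
      then show thesis using assms Off \<beta> by (intro that[of \<beta>] own) (auto simp: block_def)
    next
      case False
      then obtain \<alpha> i where \<alpha>: "\<alpha> \<in> E" "\<beta> = s \<alpha> i" using \<beta> by (auto simp: ladder_free_def)
      have on: "copy (On \<alpha> k) x \<in> supported (blocks {\<alpha>}) <+>\<^bsub>P\<^esub> G" if "x \<in> carrier F" for k x
        using \<alpha> that by (intro own) (auto simp: block_def)
      show thesis
      proof (rule that[of \<alpha>])
        show "copy j x \<in> supported (blocks {\<alpha>}) <+>\<^bsub>P\<^esub> G" if x: "x \<in> carrier F" for x
          unfolding Off \<alpha>(2) by (rule copy_Off_in_submodule[OF V \<alpha>(1) x on[OF x] on[OF f_closed[OF x]]])
      qed (use \<alpha> in simp)
    qed
  qed
qed

lemma countable_subset_part: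
  assumes S: "S \<subseteq> carrier Q" "countable S"
  obtains A where "countable A" "A \<subseteq> E \<union> ladder_free W s" "S \<subseteq> part A"
proof -
  have "\<forall>C\<in>S. \<exists>p\<in>carrier P. C = proj p"
    using S(1) by (auto simp: M_module_def P.quotient_module_carrier)
  then obtain r where r: "\<And>C. C \<in> S \<Longrightarrow> r C \<in> carrier P" "\<And>C. C \<in> S \<Longrightarrow> C = proj (r C)"
    by (metis bchoice)
  have "\<forall>j\<in>J. \<exists>\<alpha>. \<alpha> \<in> E \<union> ladder_free W s \<and>
      (\<forall>x\<in>carrier F. copy j x \<in> supported (blocks {\<alpha>}) <+>\<^bsub>P\<^esub> G)"
    using copy_in_block by metis
  then obtain a where a: "\<And>j. j \<in> J \<Longrightarrow> a j \<in> E \<union> ladder_free W s"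
    and copy_a: "\<And>j x. \<lbrakk>j \<in> J; x \<in> carrier F\<rbrakk> \<Longrightarrow> copy j x \<in> supported (blocks {a j}) <+>\<^bsub>P\<^esub> G"
    by (metis bchoice)
  define B where "B = (\<Union>C\<in>S. {j \<in> J. r C j \<noteq> \<zero>\<^bsub>F\<^esub>})"
  have "countable B"
    unfolding B_def
  proof (rule countable_UN[OF S(2)])
    show "countable {j \<in> J. r C j \<noteq> \<zero>\<^bsub>F\<^esub>}" if "C \<in> S" for C
      using r(1)[OF that] by (intro countable_finite) (simp add: P_module_def direct_sum_carrier)
  qed
  let ?A = "a ` B"
  let ?V = "supported (blocks ?A) <+>\<^bsub>P\<^esub> G"
  have "supported B \<subseteq> ?V"
  proof (rule supported_subset_submodule)
    show "submodule ?V R P" by (rule P.submodule_set_add[OF supported_submodule G_submodule])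
    fix j x assume j: "j \<in> J" "j \<in> B" and x: "x \<in> carrier F"
    have "supported (blocks {a j}) \<subseteq> supported (blocks ?A)"
      using j(2) by (intro supported_mono blocks_mono) auto
    then have "supported (blocks {a j}) <+>\<^bsub>P\<^esub> G \<subseteq> ?V"
      by (auto simp: set_add_def')
    then show "copy j x \<in> ?V" using copy_a[OF j(1) x] by blast
  qed
  moreover have "r C \<in> supported B" if "C \<in> S" for C
    using that r(1) by (auto simp: supported_def B_def)
  ultimately have "proj (r C) \<in> proj ` ?V" if "C \<in> S" for C
    using that by blast
  then have "S \<subseteq> part ?A"
    using r(2) unfolding part_eq P.coset_image_set_add[OF G_submodule supported_submodule] by force
  moreover have "?A \<subseteq> E \<union> ladder_free W s"
    using a by (auto simp: B_def)
  ultimately show thesis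
    using \<open>countable B\<close> by (intro that[of ?A]) auto
qed

lemma parts_dense_system:
  defines "\<U> \<equiv> part ` {A. countable A \<and> A \<subseteq> E \<union> ladder_free W s}"
  shows "aleph1_dense_system R Q \<U>"
  unfolding aleph1_dense_system_def
proof (intro conjI ballI allI impI)
  show "submodule U R Q" if "U \<in> \<U>" for U
    using that part_submodule by (auto simp: \<U>_def)
  have "part {} \<in> \<U>"
    unfolding \<U>_def by (rule imageI) simp
  then show "\<U> \<noteq> {}" by blast
  show "\<exists>W\<in>\<U>. U \<subseteq> W \<and> V \<subseteq> W" if "U \<in> \<U>" "V \<in> \<U>" for U V
  proof -
    from that obtain A B where AB: "countable A" "A \<subseteq> E \<union> ladder_free W s" "U = part A"
      "countable B" "B \<subseteq> E \<union> ladder_free W s" "V = part B"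
      by (auto simp: \<U>_def)
    then have "part (A \<union> B) \<in> \<U>"
      unfolding \<U>_def by (intro imageI) auto
    then show ?thesis
      using AB part_mono[of A "A \<union> B"] part_mono[of B "A \<union> B"] by blast
  qed
  show "\<Union>\<C> \<in> \<U>" if sub: "\<C> \<subseteq> \<U>"
    and C: "\<C> \<noteq> {} \<and> countable \<C> \<and> Well_order {(U, V). U \<in> \<C> \<and> V \<in> \<C> \<and> U \<subseteq> V}" for \<C>
  proof -
    have "\<forall>U\<in>\<C>. \<exists>A. countable A \<and> A \<subseteq> E \<union> ladder_free W s \<and> part A = U"
      using sub by (auto simp: \<U>_def)
    then obtain a where a: "\<And>U. U \<in> \<C> \<Longrightarrow> countable (a U) \<and> a U \<subseteq> E \<union> ladder_free W s \<and> part (a U) = U"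
      by (metis bchoice)
    let ?r = "{(U, V). U \<in> \<C> \<and> V \<in> \<C> \<and> U \<subseteq> V}"
    have Field: "Field ?r = \<C>"
      by (auto simp: Field_def)
    have "total_on \<C> ?r"
      using C by (simp add: well_order_on_def linear_order_on_def Field)
    then have "U \<subseteq> V \<or> V \<subseteq> U" if "U \<in> \<C>" "V \<in> \<C>" for U V
      using that by (auto simp: total_on_def)
    then have "\<Union>\<C> = part (\<Union>U\<in>\<C>. a U)"
      using C a by (intro chain_Union_part) auto
    moreover have "part (\<Union>U\<in>\<C>. a U) \<in> \<U>"
      unfolding \<U>_def using C a by (intro imageI) auto
    ultimately show ?thesis by simp
  qed
  show "\<exists>U\<in>\<U>. S \<subseteq> U" if S: "S \<subseteq> carrier Q \<and> countable S" for S
  proof -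
    obtain A where "countable A" "A \<subseteq> E \<union> ladder_free W s" "S \<subseteq> part A"
      using countable_subset_part S by metis
    then show ?thesis
      unfolding \<U>_def by blast
  qed
qed

end

section \<open>Ladders in a well-order without last element\<close>

text \<open>The predecessor alone is cofinal below a successor.\<close>

lemma succ_not_cof_omega:
  assumes W: "Well_order W" and \<sigma>: "aboveS W \<sigma> \<noteq> {}"
  shows "wo_rel.succ W \<sigma> \<notin> cof_omega W"
proof
  interpret wo_rel W using W by (simp add: wo_rel_def)
  assume "succ \<sigma> \<in> cof_omega W"
  then have cof: "\<And>C. cofinal_below W (succ \<sigma>) C \<Longrightarrow> natLeq \<le>o |C|"
    by (auto simp: cof_omega_def has_cofinality_def)
  have "cofinal_below W (succ \<sigma>) {\<sigma>}"
    using succ_in_diff[OF \<sigma>] less_succ[OF \<sigma>] by (auto simp: cofinal_below_def underS_def)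
  then have "\<not> finite {\<sigma>}"
    using cof infinite_iff_natLeq_ordLeq by blast
  then show False by simp
qed

lemma ladder_in_Field:
  assumes "ladder_system W s" "\<nu> \<in> cof_omega W" shows "s \<nu> i \<in> Field W"
  using assms by (auto simp: ladder_system_def underS_def Field_def)

text \<open>
  A ladder point is an iterated successor \<open>\<tau> + i + 1\<close>, so its summand in \<open>P\<close> is a single copy of \<open>F\<close>. Since \<^const>\<open>wo_rel.succ\<close> has a meaningful value only
  below some other element, the well-order must have no last element.
\<close>

lemma ladder_not_cof_omega:
  assumes W: "Well_order W" and unbounded: "\<And>\<alpha>. \<alpha> \<in> Field W \<Longrightarrow> aboveS W \<alpha> \<noteq> {}"
    and s: "ladder_system W s" and \<nu>: "\<nu> \<in> cof_omega W"
  shows "s \<nu> i \<notin> cof_omega W"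
proof -
  interpret wo_rel W using W by (simp add: wo_rel_def)
  obtain \<tau> where \<tau>: "\<tau> \<in> Field W" and eq: "s \<nu> i = (succ ^^ (i + 1)) \<tau>"
    using s \<nu> unfolding ladder_system_def by metis
  have "(succ ^^ n) \<tau> \<in> Field W" for n
    by (induction n) (use \<tau> unbounded in auto)
  then show ?thesis
    using succ_not_cof_omega[OF W unbounded] by (simp add: eq)
qed

lemma ladder_system_inj:
  assumes s: "ladder_system W s" and \<nu>: "\<nu> \<in> cof_omega W" shows "inj (s \<nu>)"
proof (rule injI)
  fix i j assume eq: "s \<nu> i = s \<nu> j"
  have "s \<nu> i \<noteq> s \<nu> j" if "i < j" for i j
    using s \<nu> that by (auto simp: ladder_system_def underS_def)
  from this[of i j] this[of j i] eq show "i = j"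
    by (cases i j rule: linorder_cases) auto
qed

text \<open>
  If \<open>\<mu> < \<nu>\<close>, the ladder of \<open>\<nu>\<close> eventually exceeds \<open>\<mu>\<close>, while the ladder of \<open>\<mu>\<close> stays below \<open>\<mu>\<close>. Only the
  initial segment of the ladder of \<open>\<nu>\<close> can be shared.
\<close>

lemma ladder_system_almost_disjoint:
  assumes W: "Well_order W" and s: "ladder_system W s"
    and \<mu>: "\<mu> \<in> cof_omega W" and \<nu>: "\<nu> \<in> cof_omega W" and ne: "\<mu> \<noteq> \<nu>"
  shows "finite (range (s \<mu>) \<inter> range (s \<nu>))"
proof -
  interpret wo_rel W using W by (simp add: wo_rel_def)
  have below: "(s \<xi> i, \<xi>) \<in> W" "s \<xi> i \<noteq> \<xi>" if "\<xi> \<in> cof_omega W" for \<xi> i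
    using s that by (auto simp: ladder_system_def underS_def)
  have mono: "(s \<xi> i, s \<xi> j) \<in> W" if "\<xi> \<in> cof_omega W" "i \<le> j" for \<xi> i j
  proof (cases "i = j")
    case True
    then show ?thesis using REFL ladder_in_Field[OF s that(1)] by (auto simp: refl_on_def)
  next
    case False
    then show ?thesis using s that by (auto simp: ladder_system_def underS_def)
  qed
  have "finite (range (s \<mu>) \<inter> range (s \<nu>))"
    if \<mu>: "\<mu> \<in> cof_omega W" and \<nu>: "\<nu> \<in> cof_omega W" and less: "(\<mu>, \<nu>) \<in> W" "\<mu> \<noteq> \<nu>" for \<mu> \<nu>
  proof -
    have "\<exists>j. (s \<nu> j, \<mu>) \<notin> W"
    proof (rule ccontr)
      assume "\<nexists>j. (s \<nu> j, \<mu>) \<notin> W"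
      then have "\<mu> \<in> Above (range (s \<nu>))"
        using \<mu> by (auto simp: Above_def cof_omega_def)
      then have "(supr (range (s \<nu>)), \<mu>) \<in> W"
        unfolding supr_def by (intro minim_least) (auto simp: Above_def)
      then have "(\<nu>, \<mu>) \<in> W" using s \<nu> by (simp add: ladder_system_def)
      then show False using less ANTISYM by (auto simp: antisym_def)
    qed
    then obtain j where j: "(s \<nu> j, \<mu>) \<notin> W" by blast
    have "range (s \<mu>) \<inter> range (s \<nu>) \<subseteq> s \<nu> ` {..<j}"
    proof
      fix \<beta> assume "\<beta> \<in> range (s \<mu>) \<inter> range (s \<nu>)"
      then obtain i k where i: "\<beta> = s \<nu> i" and k: "\<beta> = s \<mu> k" by auto
      have "\<not> j \<le> i"
      proof
        assume "j \<le> i"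
        then have "(s \<nu> j, \<beta>) \<in> W" unfolding i by (rule mono[OF \<nu>])
        moreover have "(\<beta>, \<mu>) \<in> W" unfolding k by (rule below(1)[OF \<mu>])
        ultimately show False using j TRANS by (meson transD)
      qed
      then show "\<beta> \<in> s \<nu> ` {..<j}" using i by auto
    qed
    then show ?thesis by (rule finite_subset) simp
  qed
  note one = this
  have "(\<mu>, \<nu>) \<in> W \<or> (\<nu>, \<mu>) \<in> W"
    using TOTALS \<mu> \<nu> by (auto simp: cof_omega_def)
  then show ?thesis
    using one[OF \<mu> \<nu>] one[OF \<nu> \<mu>] ne by (auto simp: Int_commute)
qed

theorem theorem5p7:
  fixes R :: "('r, 'a) ring_scheme"
    and F :: "('r, 'f, 'b) module_scheme"
    and f :: "nat \<Rightarrow> 'f \<Rightarrow> 'f"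
    and \<kappa> :: "'k rel"
    and s :: "'k set \<Rightarrow> nat \<Rightarrow> 'k set"
  defines "W \<equiv> cardSuc \<kappa>"
  defines "N \<equiv> direct_limit R (\<lambda>_. F) f"
  defines "M \<equiv> M_module R F f W s"
    and "\<T> \<equiv> {A. countable A \<and> A \<subseteq> cof_omega W \<union> ladder_free W s}"
  defines "\<U> \<equiv> M_part R F f W s ` \<T>"
  assumes "ring R"
    and "Cinfinite \<kappa>"
    and "right_module R F"
    and "\<And>i. f i \<in> right_module_hom R F F"
    and "carrier N \<noteq> {\<zero>\<^bsub>N\<^esub>}"
    and "ladder_system W s"
  shows "aleph1_dense_system R M \<U> \<and> (\<forall>U\<in>\<U>. is_countable_sum_of R F (M\<lparr>carrier := U\<rparr>))"
proof -
  \<comment> \<open>An infinite cardinal, viewed as a well-order, has no last element.\<close>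
  have W: "Cinfinite W"
    unfolding W_def by (rule Cinfinite_cardSuc) fact
  then have wo: "Well_order W"
    by (simp add: card_order_on_well_order_on)
  have unbounded: "aboveS W \<alpha> \<noteq> {}" if "\<alpha> \<in> Field W" for \<alpha>
    using infinite_Card_order_limit[of W \<alpha>] W that by (auto simp: aboveS_def cinfinite_def)
  interpret L: ladder_quotient R F f W s
  proof (intro ladder_quotient.intro ladder_quotient_axioms.intro)
    show "s \<alpha> i \<in> Field W - cof_omega W" if "\<alpha> \<in> cof_omega W" for \<alpha> i
      using ladder_in_Field[OF assms(11) that] ladder_not_cof_omega[OF wo unbounded assms(11) that] by blast
    show "inj (s \<alpha>)" if "\<alpha> \<in> cof_omega W" for \<alpha>
      by (rule ladder_system_inj[OF assms(11) that])
    show "finite (range (s \<alpha>) \<inter> range (s \<beta>))"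
      if "\<alpha> \<in> cof_omega W" "\<beta> \<in> cof_omega W" "\<alpha> \<noteq> \<beta>" for \<alpha> \<beta>
      by (rule ladder_system_almost_disjoint[OF wo assms(11) that])
  qed (fact assms)+
  show ?thesis
    using L.parts_dense_system L.part_countable_sum unfolding M_def \<U>_def \<T>_def by blast
qed

end
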